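(* Let $(u_n)_{0\le n\le N}$ be the value functions defined in the context, and let the functions $(\theta_n)_{0\le n\le N}$ be defined by the change of variables $$u_{n}(x,q,S,A)=-\exp\left(-\gamma\left(-x+qS-\theta_{n}(q,S,A)\right)\right).$$ Then $(\theta_n)_n$ satisfies $$\theta_{n}(q,S,A)=\begin{cases} F\left(\dfrac{S}{A}-1\right)+\ell\left(\dfrac{F}{A}-q\right) & \text{if } n=N,\\[2mm] \min\left\{\tilde{\theta}_{n,n+1}(q,S,A),\;F\left(\dfrac{S}{A}-1\right)+\ell\left(\dfrac{F}{A}-q\right)\right\} & \text{if } n\in\mathcal{N},\\[2mm] \tilde{\theta}_{n,n+1}(q,S,A) & \text{otherwise}, \end{cases}$$ where $$\tilde{\theta}_{n,n+1}(q,S,A)=\inf_{\underline{\rho} V_{n+1} \le v \le \overline{\rho} V_{n+1}}\frac{1}{\gamma}\log\Bigg(\mathbb{E}\Bigg[\exp\Bigg(-\gamma\Bigg(q\sigma\sqrt{\delta t}\,\epsilon_{n+1}-L\left(\frac{v}{V_{n+1}}\right)V_{n+1}\delta t$$ $$-\theta_{n+1}\left(q+v\delta t,\;S+\sigma\sqrt{\delta t}\,\epsilon_{n+1},\;\frac{n}{n+1}A+\frac{1}{n+1}S+\frac{1}{n+1}\sigma\sqrt{\delta t}\,\epsilon_{n+1}\right)\Bigg)\Bigg)\Bigg]\Bigg).$$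
   Context: Setting. Discrete-time model with time indices $0,\dots,N$ and time step $\delta t>0$. Let $(\Omega,(\mathcal{F}_n)_{0\le n\le N},\mathbb{P})$ be a filtered probability space whose filtration satisfies the usual assumptions; all random variables are defined on it. The random variables $(\epsilon_n)_n$ are i.i.d. with mean $0$, variance $1$ and a moment-generating function defined on $\mathbb{R}_+$, and $\epsilon_{n+1}$ is $\mathcal{F}_{n+1}$-measurable. $\sigma>0$ is the volatility parameter, $F>0$ the notional of the contract, $\gamma>0$ the absolute risk aversion parameter. The market volume process $(V_n)_n$ ($V_{n+1}\delta t$ is the market volume over the period between time indices $n$ and $n+1$) is $\mathcal{F}_0$-measurable. $\underline{\rho},\overline{\rho}$ are bounds on the participation rate ($\underline{\rho}$ can be of either sign). $\mathcal{N}\subset\{1,\dots,N-1\}$ is a non-empty set (time indices at which the option can be exercised early). The execution cost function $L:\mathbb{R}\to\mathbb{R}_+$ is continuous, strictly convex, even, increasing on $\mathbb{R}_+$, with $L(0)=0$ and $\lim_{\rho\to+\infty}L(\rho)/\rho=+\infty$. The penalty function is $\ell(q)=\frac{L(\rho)}{\rho}|q|+\frac{\gamma\sigma^2}{6\rho V}|q|^3$, where $\rho$ is a constant participation rate and $V$ is the average value of the market volume process. State variables. For $0\le n\le k\le N$ and $k>0$: $$X_{k}^{n,x,v}=x+\sum_{j=n}^{k-1}\left(v_{j}S_{j+1}^{n,S}\delta t+L\left(\tfrac{v_{j}}{V_{j+1}}\right)V_{j+1}\delta t\right),\qquad q_{k}^{n,q,v}=q+\sum_{j=n}^{k-1}v_{j}\delta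 t,$$ $$S_{k}^{n,S}=S+\sigma\sqrt{\delta t}\sum_{j=n}^{k-1}\epsilon_{j+1},\qquad A_{k}^{n,A,S}=\frac{n}{k}A+\frac{1}{k}\sum_{j=n}^{k-1}S_{j+1}^{n,S}.$$ Admissible strategies. $\mathcal{A}_n$ is the set of pairs $(v,n^\star)$ where $v=(v_k)_{n\le k\le n^\star-1}$ is $(\mathcal{F})$-adapted with $\underline{\rho}V_{k+1}\le v_k\le\overline{\rho}V_{k+1}$, and $n^\star$ is an $(\mathcal{F})$-stopping time taking values in $(\mathcal{N}\cup\{N\})\cap\{n,\dots,N\}$. Value functions. For $0\le n\le N$: $$u_{n}(x,q,S,A)= \sup_{(v,n^{\star})\in\mathcal{A}_{n}}\mathbb{E}\left[-\exp\left(-\gamma\left(F-X_{n^{\star}}^{n,x,v}-\left(\frac{F}{A^{n,A,S}_{n^{\star}}}- q^{n,q,v}_{n^{\star}}\right)S^{n,S}_{n^{\star}} - \ell\left(\frac{F}{A^{n,A,S}_{n^{\star}}}- q^{n,q,v}_{n^{\star}}\right)\right)\right)\right].$$ When $n=0$, the functions $u_0$ and $\theta_0$ are independent of $A$.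
   Formalization: Added: each ε_{n+1} is independent of F_n, and F_0 is trivial up to null sets, so V is a.s. constant (otherwise the recursion fails); also V>0, ρ>0 and ordered participation bounds. Values may be infinite, and the recursion holds for almost every realised V. *)

theory Defs
  imports "HOL-Probability.Probability"
begin

section \<open>Exponential and logarithm with infinite values\<close>

definition exp_ereal :: "ereal \<Rightarrow> ennreal" where
  "exp_ereal t = (case t of ereal r \<Rightarrow> ennreal (exp r) | PInfty \<Rightarrow> \<infinity> | MInfty \<Rightarrow> 0)"

definition ln_ennreal :: "ennreal \<Rightarrow> ereal" where
  "ln_ennreal y = (if y = 0 then -\<infinity> else if y = \<infinity> then \<infinity> else ereal (ln (enn2real y)))"

definition strictly_convex :: "(real \<Rightarrow> real) \<Rightarrow> bool" where
  "strictly_convex f \<longleftrightarrow>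
     (\<forall>x y t. x \<noteq> y \<longrightarrow> 0 < t \<longrightarrow> t < 1 \<longrightarrow>
        f ((1 - t) * x + t * y) < (1 - t) * f x + t * f y)"


section \<open>The model\<close>

text \<open>The filtration is indexed by all of \<open>nat\<close> to fit the library; only the indices up to
  \<open>horizon\<close> matter. Likewise only \<open>noise k\<close> and \<open>volume k\<close> with \<open>1 \<le> k \<le> horizon\<close> are used,
  \<open>volume (Suc n) * dt\<close> being the market volume between the time indices \<open>n\<close> and \<open>Suc n\<close>.\<close>

record 'a asr =
  probm :: "'a measure"
  filt :: "nat \<Rightarrow> 'a measure"
  horizon :: nat
  dt :: real
  noise :: "nat \<Rightarrow> 'a \<Rightarrow> real"
  vol :: real
  notional :: real
  risk_av :: real
  volume :: "nat \<Rightarrow> 'a \<Rightarrow> real"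
  rho_lo :: real
  rho_hi :: real
  exercise :: "nat set"
  cost :: "real \<Rightarrow> real"
  rho_pen :: real \<comment> \<open>the constant participation rate in the penalty function\<close>

text \<open>The usual assumptions reduce to completeness in discrete time. \<open>noise_indep_filt\<close> (the noise
  is an innovation) and \<open>filt_0_trivial\<close> (so that volumes known at time 0 are almost surely
  constant, and the value functions deterministic) are the standard conventions behind the dynamic
  programming principle.\<close>

locale asr_model =
  prob_space "probm P" + complete_measure "probm P" + filtration "space (probm P)" "filt P"
  for P :: "'a asr" +
  assumes filt_sub: "\<And>n. subalgebra (probm P) (filt P n)"
    and filt_complete: "null_sets (probm P) \<subseteq> sets (filt P 0)"
    and filt_0_trivial: "\<And>B. B \<in> sets (filt P 0) \<Longrightarrow> prob B = 0 \<or> prob B = 1"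
    and dt_pos: "dt P > 0"
    and vol_pos: "vol P > 0"
    and notional_pos: "notional P > 0"
    and risk_av_pos: "risk_av P > 0"
    and noise_adapted: "\<And>k. k \<in> {1..horizon P} \<Longrightarrow> noise P k \<in> borel_measurable (filt P k)"
    and noise_indep: "indep_vars (\<lambda>_. borel) (noise P) {1..horizon P}"
    and noise_indep_filt: "\<And>k. k < horizon P \<Longrightarrow>
      indep_set (sets (filt P k)) {noise P (Suc k) -` B \<inter> space (probm P) |B. B \<in> sets borel}"
    and noise_identical: "\<And>j k. j \<in> {1..horizon P} \<Longrightarrow> k \<in> {1..horizon P} \<Longrightarrow>
      distr (probm P) borel (noise P j) = distr (probm P) borel (noise P k)"
    and noise_integrable: "\<And>k. k \<in> {1..horizon P} \<Longrightarrow> integrable (probm P) (noise P k)"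
    and noise_mean: "\<And>k. k \<in> {1..horizon P} \<Longrightarrow> expectation (noise P k) = 0"
    and noise_sq_integrable: "\<And>k. k \<in> {1..horizon P} \<Longrightarrow>
      integrable (probm P) (\<lambda>\<omega>. (noise P k \<omega>)\<^sup>2)"
    and noise_variance: "\<And>k. k \<in> {1..horizon P} \<Longrightarrow> variance (noise P k) = 1"
    and noise_mgf: "\<And>k t. k \<in> {1..horizon P} \<Longrightarrow> t \<ge> 0 \<Longrightarrow>
      integrable (probm P) (\<lambda>\<omega>. exp (t * noise P k \<omega>))"
    and volume_measurable: "\<And>k. k \<in> {1..horizon P} \<Longrightarrow> volume P k \<in> borel_measurable (filt P 0)"
    and volume_pos: "\<And>k. k \<in> {1..horizon P} \<Longrightarrow> AE \<omega> in probm P. volume P k \<omega> > 0"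
    and rho_le: "rho_lo P \<le> rho_hi P"
    and exercise_subset: "exercise P \<subseteq> {1..<horizon P}"
    and exercise_nonempty: "exercise P \<noteq> {}"
    and cost_nonneg: "\<And>r. cost P r \<ge> 0"
    and cost_continuous: "continuous_on UNIV (cost P)"
    and cost_convex: "strictly_convex (cost P)"
    and cost_even: "\<And>r. cost P (- r) = cost P r"
    and cost_mono: "mono_on {0..} (cost P)"
    and cost_0: "cost P 0 = 0"
    and cost_superlinear: "filterlim (\<lambda>r. cost P r / r) at_top at_top"
    and rho_pen_pos: "rho_pen P > 0"

definition mean_volume :: "'a asr \<Rightarrow> 'a \<Rightarrow> real" where
  "mean_volume P \<omega> = (\<Sum>k = 1..horizon P. volume P k \<omega>) / real (horizon P)"

definition penalty :: "'a asr \<Rightarrow> 'a \<Rightarrow> real \<Rightarrow> real" where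
  "penalty P \<omega> q =
     cost P (rho_pen P) / rho_pen P * \<bar>q\<bar>
     + risk_av P * (vol P)\<^sup>2 / (6 * rho_pen P * mean_volume P \<omega>) * \<bar>q\<bar> ^ 3"


section \<open>State variables, strategies and value functions\<close>

definition price :: "'a asr \<Rightarrow> nat \<Rightarrow> real \<Rightarrow> nat \<Rightarrow> 'a \<Rightarrow> real" where
  "price P n S k \<omega> = S + vol P * sqrt (dt P) * (\<Sum>j = n..<k. noise P (Suc j) \<omega>)"

definition inventory :: "'a asr \<Rightarrow> nat \<Rightarrow> real \<Rightarrow> (nat \<Rightarrow> 'a \<Rightarrow> real) \<Rightarrow> nat \<Rightarrow> 'a \<Rightarrow> real" where
  "inventory P n q v k \<omega> = q + (\<Sum>j = n..<k. v j \<omega> * dt P)"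

definition cash ::
    "'a asr \<Rightarrow> nat \<Rightarrow> real \<Rightarrow> real \<Rightarrow> (nat \<Rightarrow> 'a \<Rightarrow> real) \<Rightarrow> nat \<Rightarrow> 'a \<Rightarrow> real" where
  "cash P n x S v k \<omega> =
     x + (\<Sum>j = n..<k. v j \<omega> * price P n S (Suc j) \<omega> * dt P
            + cost P (v j \<omega> / volume P (Suc j) \<omega>) * volume P (Suc j) \<omega> * dt P)"

definition avg_price :: "'a asr \<Rightarrow> nat \<Rightarrow> real \<Rightarrow> real \<Rightarrow> nat \<Rightarrow> 'a \<Rightarrow> real" where
  "avg_price P n A S k \<omega> =
     real n / real k * A + 1 / real k * (\<Sum>j = n..<k. price P n S (Suc j) \<omega>)"

text \<open>A strategy \<open>v\<close> is a total process, but it is constrained, and enters the payoff below, only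
  at the indices \<open>k\<close> with \<open>n \<le> k < T\<close>.\<close>

definition admissible :: "'a asr \<Rightarrow> nat \<Rightarrow> ((nat \<Rightarrow> 'a \<Rightarrow> real) \<times> ('a \<Rightarrow> nat)) set" where
  "admissible P n = {(v, T).
     stopping_time (filt P) T \<and>
     (\<forall>\<omega> \<in> space (probm P). T \<omega> \<in> (exercise P \<union> {horizon P}) \<inter> {n..horizon P}) \<and>
     (\<forall>k \<in> {n..<horizon P}. v k \<in> borel_measurable (filt P k)) \<and>
     (AE \<omega> in probm P. \<forall>k \<in> {n..<T \<omega>}.
        rho_lo P * volume P (Suc k) \<omega> \<le> v k \<omega> \<and> v k \<omega> \<le> rho_hi P * volume P (Suc k) \<omega>)}"

definition payoff ::
    "'a asr \<Rightarrow> nat \<Rightarrow> real \<Rightarrow> real \<Rightarrow> real \<Rightarrow> real \<Rightarrow> (nat \<Rightarrow> 'a \<Rightarrow> real) \<Rightarrow> ('a \<Rightarrow> nat)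
      \<Rightarrow> 'a \<Rightarrow> real" where
  "payoff P n x q S A v T \<omega> =
     notional P - cash P n x S v (T \<omega>) \<omega>
     - (notional P / avg_price P n A S (T \<omega>) \<omega> - inventory P n q v (T \<omega>) \<omega>) * price P n S (T \<omega>) \<omega>
     - penalty P \<omega> (notional P / avg_price P n A S (T \<omega>) \<omega> - inventory P n q v (T \<omega>) \<omega>)"

text \<open>Exponential moments of the payoff may be infinite (the averaged price can come arbitrarily
  close to 0), and the Bochner integral of a non-integrable function is 0. The expectation of the
  negative integrand is therefore minus a nonnegative integral, with values in \<open>[-\<infinity>, 0]\<close>.\<close>

definition value_fn :: "'a asr \<Rightarrow> nat \<Rightarrow> real \<Rightarrow> real \<Rightarrow> real \<Rightarrow> real \<Rightarrow> ereal" where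
  "value_fn P n x q S A =
     (SUP (v, T) \<in> admissible P n.
        - enn2ereal (\<integral>\<^sup>+ \<omega>. ennreal (exp (- risk_av P * payoff P n x q S A v T \<omega>)) \<partial>probm P))"

definition change_of_variables :: "'a asr \<Rightarrow> (nat \<Rightarrow> real \<Rightarrow> real \<Rightarrow> real \<Rightarrow> ereal) \<Rightarrow> bool" where
  "change_of_variables P \<theta> \<longleftrightarrow>
     (\<forall>n \<le> horizon P. \<forall>x q S A.
        value_fn P n x q S A =
          - enn2ereal (exp_ereal (ereal (- risk_av P) * (ereal (- x + q * S) - \<theta> n q S A))))"


section \<open>The terms of the recursion\<close>

definition exercise_term :: "'a asr \<Rightarrow> 'a \<Rightarrow> real \<Rightarrow> real \<Rightarrow> real \<Rightarrow> real" where
  "exercise_term P \<omega> q S A = notional P * (S / A - 1) + penalty P \<omega> (notional P / A - q)"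

text \<open>The outcome \<open>\<omega>\<close> only selects the volume known at time 0; the expectation is over \<open>\<omega>'\<close>.\<close>

definition continuation_term ::
    "'a asr \<Rightarrow> (nat \<Rightarrow> real \<Rightarrow> real \<Rightarrow> real \<Rightarrow> ereal) \<Rightarrow> 'a \<Rightarrow> nat \<Rightarrow> real \<Rightarrow> real \<Rightarrow> real \<Rightarrow> ereal" where
  "continuation_term P \<theta> \<omega> n q S A =
     (INF v \<in> {rho_lo P * volume P (Suc n) \<omega> .. rho_hi P * volume P (Suc n) \<omega>}.
        ereal (1 / risk_av P) * ln_ennreal (\<integral>\<^sup>+ \<omega>'.
          exp_ereal (ereal (- risk_av P) *
            (ereal (q * vol P * sqrt (dt P) * noise P (Suc n) \<omega>'
                    - cost P (v / volume P (Suc n) \<omega>) * volume P (Suc n) \<omega> * dt P)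
             - \<theta> (Suc n)
                 (q + v * dt P)
                 (S + vol P * sqrt (dt P) * noise P (Suc n) \<omega>')
                 (real n / real (Suc n) * A + 1 / real (Suc n) * S
                    + 1 / real (Suc n) * vol P * sqrt (dt P) * noise P (Suc n) \<omega>')))
          \<partial>probm P))"

end

theory Submission
  imports Defs
begin

text \<open>The volumes are almost surely constant, so the problem is Markovian in \<open>(q, S, A)\<close>. Let \<open>W\<^sub>n\<close> be
  defined by the backward recursion for \<open>exp (\<gamma> \<theta>\<^sub>n)\<close>. The terminal cost is jointly lower semicontinuous on
  all of \<open>\<real>\<^sup>3\<close>, since its cubic part makes it explode as \<open>A \<rightarrow> 0\<close>; by Fatou's lemma and compactness of
  the control interval this passes through the recursion. Hence every \<open>W\<^sub>n\<close> is Borel, the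
  minimum over \<open>v\<close> is attained, and its least minimiser is a Borel function of the state: no
  measurable selection theorem is needed.

  Along a strategy, \<open>exp (\<gamma> (X\<^sub>k - q\<^sub>k S\<^sub>k)) W\<^sub>k(q\<^sub>k, S\<^sub>k, A\<^sub>k)\<close> has nondecreasing expectation up to the stopping
  time, because the next noise is independent of the past and can be integrated out first; it has
  constant expectation for the feedback strategy built from the least minimisers and the first time at
  which exercising is optimal. So \<open>W\<^sub>n\<close> is, up to the factor \<open>exp (\<gamma> (x - q S))\<close>, the optimal expected cost.\<close>

section \<open>Lower semicontinuous functions\<close>

text \<open>Closed sublevel sets feed directly into Borel measurability and closed projections;
  \<open>lsc_liminf\<close> and \<open>lscI\<close> pass to and from the sequential form that
  Fatou's lemma needs.\<close>

definition lsc :: "('a::topological_space \<Rightarrow> ennreal) \<Rightarrow> bool" where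
  "lsc f \<longleftrightarrow> (\<forall>c. closed {x. f x \<le> c})"

lemma lscD: "lsc f \<Longrightarrow> closed {x. f x \<le> c}"
  by (simp add: lsc_def)

lemma lsc_liminf:
  assumes "lsc f" and "X \<longlonglongrightarrow> l"
  shows "f l \<le> liminf (\<lambda>n. f (X n))"
  unfolding le_Liminf_iff
proof (intro allI impI)
  fix y assume "y < f l"
  moreover have "open {x. y < f x}"
    using lscD[OF assms(1), of y] by (simp add: closed_def Collect_neg_eq[symmetric] not_le)
  ultimately show "\<forall>\<^sub>F n in sequentially. y < f (X n)"
    using topological_tendstoD[OF assms(2), of "{x. y < f x}"] by simp
qed

lemma lscI:
  fixes f :: "'a::first_countable_topology \<Rightarrow> ennreal"
  assumes "\<And>X l. X \<longlonglongrightarrow> l \<Longrightarrow> f l \<le> liminf (\<lambda>n. f (X n))"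
  shows "lsc f"
  unfolding lsc_def closed_sequential_limits
proof (intro allI impI, elim conjE)
  fix c X l assume X: "\<forall>n. X n \<in> {x. f x \<le> c}" "X \<longlonglongrightarrow> l"
  have "f l \<le> liminf (\<lambda>n. f (X n))" by (rule assms[OF X(2)])
  also have "\<dots> \<le> c" using X(1) by (intro Liminf_le) auto
  finally show "l \<in> {x. f x \<le> c}" by simp
qed

lemma lsc_borel_measurable: "lsc f \<Longrightarrow> f \<in> borel_measurable borel"
  by (rule borel_measurableI_le) (auto intro: borel_closed dest: lscD)

lemma lsc_min: "lsc f \<Longrightarrow> lsc g \<Longrightarrow> lsc (\<lambda>x. min (f x) (g x))"
  by (simp add: lsc_def min_le_iff_disj Collect_disj_eq closed_Un)

lemma lsc_compose:
  assumes "lsc f" and "continuous_on UNIV g"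
  shows "lsc (\<lambda>x. f (g x))"
  unfolding lsc_def
proof
  fix c
  have "closed (g -` {x. f x \<le> c})"
    using closed_vimage[OF lscD[OF assms(1)] assms(2)] .
  then show "closed {x. f (g x) \<le> c}" by (simp add: vimage_def)
qed

lemma lsc_continuous:
  assumes "continuous_on UNIV g"
  shows "lsc (\<lambda>x. ennreal (g x))"
  unfolding lsc_def
proof
  fix c
  have "continuous_on UNIV (\<lambda>x. ennreal (g x))"
    using continuous_on_ennreal[OF assms] .
  then show "closed {x. ennreal (g x) \<le> c}"
    by (intro closed_Collect_le continuous_intros) auto
qed

text \<open>A product of two tail infima is at most the infimum of the products over the common
  tail; in \<open>ennreal\<close> both suprema can then be pulled out of the product, even past
  factors that are 0 or infinite.\<close>

lemma liminf_mult_ennreal: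
  fixes f g :: "nat \<Rightarrow> ennreal"
  shows "liminf f * liminf g \<le> liminf (\<lambda>n. f n * g n)"
proof -
  have *: "(INF k\<in>{n..}. f k) * (INF k\<in>{m..}. g k) \<le> liminf (\<lambda>n. f n * g n)" for n m
  proof -
    have "(INF k\<in>{n..}. f k) * (INF k\<in>{m..}. g k) \<le> (INF k\<in>{max n m..}. f k * g k)"
      by (intro INF_greatest mult_mono INF_lower) auto
    also have "\<dots> \<le> liminf (\<lambda>n. f n * g n)"
      unfolding liminf_SUP_INF by (rule SUP_upper) auto
    finally show ?thesis .
  qed
  have "liminf f * liminf g
      = (SUP n. SUP m. (INF k\<in>{n..}. f k) * (INF k\<in>{m..}. g k))"
    unfolding liminf_SUP_INF
    by (subst SUP_mult_right_ennreal) (intro SUP_cong refl SUP_mult_left_ennreal)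
  also have "\<dots> \<le> liminf (\<lambda>n. f n * g n)"
    by (intro SUP_least *)
  finally show ?thesis .
qed

lemma lsc_mult:
  fixes f g :: "'a::first_countable_topology \<Rightarrow> ennreal"
  assumes "lsc f" and "lsc g"
  shows "lsc (\<lambda>x. f x * g x)"
proof (rule lscI)
  fix X l assume "X \<longlonglongrightarrow> (l::'a)"
  then have "f l * g l \<le> liminf (\<lambda>n. f (X n)) * liminf (\<lambda>n. g (X n))"
    by (intro mult_mono lsc_liminf[OF assms(1)] lsc_liminf[OF assms(2)]) auto
  also have "\<dots> \<le> liminf (\<lambda>n. f (X n) * g (X n))" by (rule liminf_mult_ennreal)
  finally show "f l * g l \<le> liminf (\<lambda>n. f (X n) * g (X n))" .
qed

lemma lsc_nn_integral:
  fixes h :: "'a::first_countable_topology \<Rightarrow> 'b \<Rightarrow> ennreal"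
  assumes "\<And>w. lsc (\<lambda>x. h x w)" and "\<And>x. h x \<in> borel_measurable M"
  shows "lsc (\<lambda>x. \<integral>\<^sup>+ w. h x w \<partial>M)"
proof (rule lscI)
  fix X l assume "X \<longlonglongrightarrow> (l::'a)"
  then have "(\<integral>\<^sup>+ w. h l w \<partial>M) \<le> (\<integral>\<^sup>+ w. liminf (\<lambda>n. h (X n) w) \<partial>M)"
    by (intro nn_integral_mono lsc_liminf assms)
  also have "\<dots> \<le> liminf (\<lambda>n. \<integral>\<^sup>+ w. h (X n) w \<partial>M)"
    by (intro nn_integral_liminf assms)
  finally show "(\<integral>\<^sup>+ w. h l w \<partial>M) \<le> liminf (\<lambda>n. \<integral>\<^sup>+ w. h (X n) w \<partial>M)" .
qed

text \<open>Without a minimiser the open sets \<open>{v. f w < f v}\<close> would cover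
  \<open>K\<close>; among the finitely many indices of a subcover, one of least value is covered by
  none of them.\<close>

lemma lsc_attains_INF:
  assumes "lsc f" and "compact K" and "K \<noteq> {}"
  shows "\<exists>v\<in>K. f v = (INF w\<in>K. f w)"
proof -
  have "\<exists>v\<in>K. \<forall>w\<in>K. f v \<le> f w"
  proof (rule ccontr)
    assume "\<not> ?thesis"
    then have cover: "K \<subseteq> (\<Union>w\<in>K. {v. f w < f v})" by (auto simp: not_le)
    have "open {v. f w < f v}" for w
      using lscD[OF assms(1), of "f w"] by (simp add: closed_def Collect_neg_eq[symmetric] not_le)
    then obtain D where D: "D \<subseteq> K" "finite D" "K \<subseteq> (\<Union>w\<in>D. {v. f w < f v})"
      by (rule compactE_image[OF assms(2) _ cover])
    then have "D \<noteq> {}" using assms(3) by auto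
    with D(2) have "Min (f ` D) \<in> f ` D" by (intro Min_in) auto
    then obtain w where w: "w \<in> D" "f w = Min (f ` D)" by auto
    have "w \<in> (\<Union>w\<in>D. {v. f w < f v})" using w(1) D(1,3) by (meson subsetD)
    then obtain u where "u \<in> D" "f u < f w" by auto
    moreover have "f w \<le> f u" using D(2) \<open>u \<in> D\<close> by (simp add: w(2))
    ultimately show False by simp
  qed
  then obtain v where "v \<in> K" "\<And>w. w \<in> K \<Longrightarrow> f v \<le> f w" by blast
  then show ?thesis by (intro bexI[of _ v] antisym INF_greatest INF_lower)
qed

lemma lsc_slice: "lsc (\<lambda>(x, v). \<Phi> x v) \<Longrightarrow> lsc (\<Phi> x)"
  using lsc_compose[of "\<lambda>(x, v). \<Phi> x v" "Pair x"] by (simp add: continuous_intros)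

text \<open>As the infimum is attained, its sublevel set is the projection along the compact
  \<open>K\<close> of a closed sublevel set of the joint function, hence closed.\<close>

lemma lsc_INF_compact:
  fixes \<Phi> :: "'a::euclidean_space \<Rightarrow> 'b::euclidean_space \<Rightarrow> ennreal"
  assumes "lsc (\<lambda>(x, v). \<Phi> x v)" and "compact K" and "K \<noteq> {}"
  shows "lsc (\<lambda>x. INF v\<in>K. \<Phi> x v)"
  unfolding lsc_def
proof
  fix c
  have "lsc (\<lambda>p. (\<lambda>(x, v). \<Phi> x v) (prod.swap p))"
    by (rule lsc_compose[OF assms(1)]) (simp add: prod.swap_def continuous_intros)
  then have "closed {(v, x). \<Phi> x v \<le> c}"
    using lscD[of "\<lambda>(v, x). \<Phi> x v" c] by (simp add: case_prod_unfold)
  moreover have "{x. (INF v\<in>K. \<Phi> x v) \<le> c} = {x. \<exists>v. v \<in> K \<and> (v, x) \<in> {(v, x). \<Phi> x v \<le> c}}"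
    using lsc_attains_INF[OF lsc_slice[OF assms(1)] assms(2,3)]
    by auto (metis, meson INF_lower2)
  ultimately show "closed {x. (INF v\<in>K. \<Phi> x v) \<le> c}"
    using closed_compact_projection[OF assms(2), of "{(v, x). \<Phi> x v \<le> c}"] by simp
qed

text \<open>The least minimiser is Borel: it is at most \<open>c\<close> iff the minimum over \<open>{a..c}\<close> is already
  the minimum over \<open>{a..b}\<close>.\<close>

lemma lsc_measurable_minimiser:
  fixes \<Phi> :: "'a::euclidean_space \<Rightarrow> real \<Rightarrow> ennreal"
  assumes lsc: "lsc (\<lambda>(x, v). \<Phi> x v)" and "a \<le> b"
  shows "\<exists>s\<in>borel_measurable borel. \<forall>x. s x \<in> {a..b} \<and> \<Phi> x (s x) = (INF v\<in>{a..b}. \<Phi> x v)"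
proof
  define m where "m x = (INF v\<in>{a..b}. \<Phi> x v)" for x
  \<comment> \<open>Comparing by inequality with the minimum makes \<open>B x\<close> closed, so its
    infimum \<open>s x\<close> is again a minimiser.\<close>
  define B where "B x = {v\<in>{a..b}. \<Phi> x v \<le> m x}" for x
  define s where "s x = Inf (B x)" for x
  have attained: "\<exists>v\<in>{a..c}. \<Phi> x v = (INF w\<in>{a..c}. \<Phi> x w)" if "a \<le> c" for x c
    using lsc_attains_INF[OF lsc_slice[OF lsc], of "{a..c}"] that by auto
  have "B x \<noteq> {}" for x
    using attained[OF assms(2), of x] by (auto simp: B_def m_def)
  moreover have "closed (B x)" for x
  proof -
    have "B x = {a..b} \<inter> {v. \<Phi> x v \<le> m x}" by (auto simp: B_def)
    then show ?thesis using lscD[OF lsc_slice[OF lsc]] by (auto intro!: closed_Int)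
  qed
  moreover have bdd: "bdd_below (B x)" for x
    by (rule bdd_belowI[of _ a]) (auto simp: B_def)
  ultimately have s: "s x \<in> B x" for x
    unfolding s_def by (intro closed_contains_Inf)
  show "\<forall>x. s x \<in> {a..b} \<and> \<Phi> x (s x) = (INF v\<in>{a..b}. \<Phi> x v)"
    using s by (auto simp: B_def m_def intro!: antisym INF_lower)
  have "{x. s x \<le> c} \<in> sets borel" for c
  proof -
    consider "c < a" | "b \<le> c" | "a \<le> c" "c < b" by linarith
    then show ?thesis
    proof cases
      case 1
      then have "\<not> s x \<le> c" for x using s[of x] by (auto simp: B_def)
      then show ?thesis by simp
    next
      case 2
      then have "s x \<le> c" for x using s[of x] by (auto simp: B_def)
      then show ?thesis by simp
    next
      case 3
      have "s x \<le> c \<longleftrightarrow> (INF v\<in>{a..c}. \<Phi> x v) \<le> m x" for x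
      proof
        assume "s x \<le> c"
        then show "(INF v\<in>{a..c}. \<Phi> x v) \<le> m x"
          using s[of x] by (auto simp: B_def intro: INF_lower2)
      next
        assume *: "(INF v\<in>{a..c}. \<Phi> x v) \<le> m x"
        obtain v where "v \<in> {a..c}" "\<Phi> x v = (INF v\<in>{a..c}. \<Phi> x v)"
          using attained[OF 3(1)] by blast
        with * 3 have "v \<in> B x" "v \<le> c" by (auto simp: B_def)
        then show "s x \<le> c" unfolding s_def by (meson bdd cInf_lower order_trans)
      qed
      moreover have "(\<lambda>x. INF v\<in>{a..c}. \<Phi> x v) \<in> borel_measurable borel"
        using 3 by (intro lsc_borel_measurable lsc_INF_compact lsc) auto
      moreover have "m \<in> borel_measurable borel"
        unfolding m_def using assms(2) by (intro lsc_borel_measurable lsc_INF_compact lsc) auto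
      ultimately show ?thesis by simp
    qed
  qed
  then show "s \<in> borel_measurable borel" by (auto simp: borel_measurable_iff_le)
qed

section \<open>Freezing an independent variable\<close>

text \<open>Independence makes the joint law of \<open>(Y, X)\<close> the product of the marginals,
  and Tonelli then integrates over \<open>X\<close> first. Independence from a whole sigma-algebra
  \<open>G\<close> lets \<open>Y\<close> collect everything known by then.\<close>

lemma (in prob_space) nn_integral_indep_freeze:
  assumes sub: "subalgebra M G" and Y: "Y \<in> measurable G N"
    and X: "X \<in> measurable M K"
    and indep: "indep_set (sets G) {X -` B \<inter> space M |B. B \<in> sets K}"
    and H: "(\<lambda>(y, e). H y e) \<in> borel_measurable (N \<Otimes>\<^sub>M K)"
  shows "(\<integral>\<^sup>+ w. H (Y w) (X w) \<partial>M) = (\<integral>\<^sup>+ w. (\<integral>\<^sup>+ w'. H (Y w) (X w') \<partial>M) \<partial>M)"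
proof -
  have YM: "Y \<in> measurable M N" by (rule measurable_from_subalg[OF sub Y])
  interpret Y: prob_space "distr M N Y" by (rule prob_space_distr[OF YM])
  interpret X: prob_space "distr M K X" by (rule prob_space_distr[OF X])
  have eq: "distr M N Y \<Otimes>\<^sub>M distr M K X = distr M (N \<Otimes>\<^sub>M K) (\<lambda>w. (Y w, X w))"
  proof (rule pair_measure_eqI)
    fix A B assume "A \<in> sets (distr M N Y)" and "B \<in> sets (distr M K X)"
    then have AB: "A \<in> sets N" "B \<in> sets K" by auto
    have space: "space G = space M" using sub by (simp add: subalgebra_def)
    have "prob ((Y -` A \<inter> space M) \<inter> (X -` B \<inter> space M))
        = prob (Y -` A \<inter> space M) * prob (X -` B \<inter> space M)"
      using AB measurable_sets[OF Y AB(1)] space by (intro indep_setD[OF indep]) auto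
    moreover have "(Y -` A \<inter> space M) \<inter> (X -` B \<inter> space M) = (\<lambda>w. (Y w, X w)) -` (A \<times> B) \<inter> space M"
      by auto
    ultimately show "emeasure (distr M N Y) A * emeasure (distr M K X) B
        = emeasure (distr M (N \<Otimes>\<^sub>M K) (\<lambda>w. (Y w, X w))) (A \<times> B)"
      using AB YM X by (simp add: emeasure_distr emeasure_eq_measure ennreal_mult)
  qed (auto intro: X.sigma_finite_measure_axioms Y.sigma_finite_measure_axioms)
  have "(\<integral>\<^sup>+ w. H (Y w) (X w) \<partial>M)
      = (\<integral>\<^sup>+ p. (case p of (y, e) \<Rightarrow> H y e) \<partial>distr M (N \<Otimes>\<^sub>M K) (\<lambda>w. (Y w, X w)))"
    using H YM X by (subst nn_integral_distr) auto
  also have "\<dots> = (\<integral>\<^sup>+ y. \<integral>\<^sup>+ e. H y e \<partial>distr M K X \<partial>distr M N Y)"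
    unfolding eq[symmetric] using H by (subst X.nn_integral_fst[symmetric]) (auto cong: measurable_cong_sets)
  also have "\<dots> = (\<integral>\<^sup>+ w. (\<integral>\<^sup>+ e. H (Y w) e \<partial>distr M K X) \<partial>M)"
    using H YM by (intro nn_integral_distr X.borel_measurable_nn_integral) (auto cong: measurable_cong_sets)
  also have "\<dots> = (\<integral>\<^sup>+ w. (\<integral>\<^sup>+ w'. H (Y w) (X w') \<partial>M) \<partial>M)"
  proof (rule nn_integral_cong)
    fix w assume "w \<in> space M"
    then have "Y w \<in> space N" using YM by (rule measurable_space[rotated])
    then have "H (Y w) \<in> borel_measurable K" using measurable_Pair2[OF H] by simp
    then show "(\<integral>\<^sup>+ e. H (Y w) e \<partial>distr M K X) = (\<integral>\<^sup>+ w'. H (Y w) (X w') \<partial>M)"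
      using X by (intro nn_integral_distr) auto
  qed
  finally show ?thesis .
qed

text \<open>Every event \<open>X < r\<close> is almost surely decided. Doing this for all rational
  \<open>r\<close> at once locates the value of \<open>X\<close>, since distinct reals are separated
  by a rational.\<close>

lemma (in prob_space) AE_constant_of_trivial:
  fixes X :: "'a \<Rightarrow> real"
  assumes sub: "subalgebra M G" and X: "X \<in> borel_measurable G"
    and triv: "\<And>B. B \<in> sets G \<Longrightarrow> prob B = 0 \<or> prob B = 1"
  shows "\<exists>c. AE w in M. X w = c"
proof -
  have XM: "X \<in> borel_measurable M" by (rule measurable_from_subalg[OF sub X])
  have "\<exists>b. AE w in M. X w < r \<longleftrightarrow> b" for r
  proof -
    have "X -` {..<r} \<inter> space M \<in> sets G"
      using measurable_sets[OF X, of "{..<r}"] sub by (simp add: subalgebra_def)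
    then consider "prob (X -` {..<r} \<inter> space M) = 1" | "prob (X -` {..<r} \<inter> space M) = 0"
      using triv by blast
    then show ?thesis
    proof cases
      case 1
      then have "AE w in M. w \<in> X -` {..<r} \<inter> space M" by (rule AE_prob_1)
      then have "AE w in M. X w < r \<longleftrightarrow> True" by (rule eventually_mono) auto
      then show ?thesis ..
    next
      case 2
      then have "AE w in M. w \<notin> X -` {..<r} \<inter> space M"
        using XM by (subst (asm) prob_eq_0) (auto intro: measurable_sets)
      then have "AE w in M. X w < r \<longleftrightarrow> False" using AE_space by eventually_elim auto
      then show ?thesis ..
    qed
  qed
  then have "\<forall>r. \<exists>b. AE w in M. X w < r \<longleftrightarrow> b" ..
  from choice[OF this] obtain b where b: "\<And>r. AE w in M. X w < r \<longleftrightarrow> b r" by blast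
  have ae: "AE w in M. \<forall>r\<in>\<rat>. X w < r \<longleftrightarrow> b r"
    unfolding AE_ball_countable[OF countable_rat] using b by blast
  \<comment> \<open>An almost sure property holds at some outcome; the value of \<open>X\<close>
    there is the constant.\<close>
  have "\<exists>w0. \<forall>r\<in>\<rat>. X w0 < r \<longleftrightarrow> b r"
  proof (rule ccontr)
    assume no: "\<not> ?thesis"
    have "AE w in M. False" by (rule eventually_mono[OF ae]) (use no in blast)
    then show False by simp
  qed
  then obtain w0 where w0: "\<And>r. r \<in> \<rat> \<Longrightarrow> X w0 < r \<longleftrightarrow> b r" by blast
  have "AE w in M. X w = X w0"
    using ae
  proof eventually_elim
    case (elim w)
    show ?case
    proof (rule linorder_cases)
      assume "X w < X w0"
      then obtain r where "r \<in> \<rat>" "X w < r" "r < X w0" using Rats_dense_in_real by blast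
      with elim w0[of r] show ?thesis by auto
    next
      assume "X w0 < X w"
      then obtain r where "r \<in> \<rat>" "X w0 < r" "r < X w" using Rats_dense_in_real by blast
      with elim w0[of r] show ?thesis by auto
    qed
  qed
  then show ?thesis by blast
qed

section \<open>The exercise cost is lower semicontinuous\<close>

text \<open>For \<open>u > 1\<close> the constant term is at most \<open>\<bar>a\<bar> * u\<close>;
  after cancelling one \<open>u\<close>, the bound \<open>u \<le> u * u\<close> leaves a linear
  inequality.\<close>

lemma cubic_growth_bound:
  fixes c a K u :: real
  assumes "c > 0" and "K \<ge> 0" and "u \<ge> 0" and "c * u ^ 3 \<le> a + K * u"
  shows "u \<le> max 1 ((\<bar>a\<bar> + K) / c)"
proof (cases "u \<le> 1")
  case False
  have "c * u\<^sup>2 * u = c * u ^ 3" by (simp add: power2_eq_square power3_eq_cube)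
  also have "\<dots> \<le> \<bar>a\<bar> * 1 + K * u" using assms(4) by simp
  also have "\<dots> \<le> \<bar>a\<bar> * u + K * u" using False assms(2) by (intro add_mono mult_left_mono) auto
  finally have "c * u\<^sup>2 * u \<le> (\<bar>a\<bar> + K) * u" by (simp add: algebra_simps)
  then have "c * u\<^sup>2 \<le> \<bar>a\<bar> + K" using False by simp
  moreover have "u \<le> u\<^sup>2" using False by (simp add: power2_eq_square)
  ultimately have "c * u \<le> \<bar>a\<bar> + K" using assms(1) by (meson mult_le_cancel_left_pos order_trans)
  then show ?thesis using assms(1) by (simp add: field_simps le_max_iff_disj)
qed simp

text \<open>As \<open>A \<rightarrow> 0\<close> the cubic term dominates the linear one, so sublevel sets stay away from
  \<open>A = 0\<close>, apart from points with \<open>A = 0\<close> itself, where \<open>F / A = 0\<close>.\<close>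

lemma closed_exercise_sublevel:
  fixes F c c' r :: real
  assumes "F > 0" and "c > 0" and "c' \<ge> 0"
  defines "e \<equiv> \<lambda>(q, S, A). F * (S / A - 1) + (c' * \<bar>F / A - q\<bar> + c * \<bar>F / A - q\<bar> ^ 3)"
  shows "closed {z. e z \<le> r}"
proof -
  \<comment> \<open>Since division by zero gives 0, both \<open>S / A\<close> and
    \<open>F / A\<close> vanish at \<open>A = 0\<close>, leaving a continuous function of
    \<open>q\<close>.\<close>
  have "closed {z :: real \<times> real \<times> real. snd (snd z) = 0 \<and> - F + (c' * \<bar>fst z\<bar> + c * \<bar>fst z\<bar> ^ 3) \<le> r}"
    by (intro closed_Collect_conj closed_Collect_eq closed_Collect_le continuous_intros)
  \<comment> \<open>The condition on \<open>A\<close> is open, yet the set is closed: on a sublevel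
    set, bounded \<open>q\<close> and \<open>S\<close> force \<open>F / A\<close> to be bounded,
    which keeps \<open>A\<close> away from 0 along convergent sequences.\<close>
  moreover have "closed {z. snd (snd z) \<noteq> 0 \<and> e z \<le> r}"
    unfolding closed_sequential_limits
  proof (intro allI impI, elim conjE)
    fix X l assume X: "\<forall>n. X n \<in> {z. snd (snd z) \<noteq> 0 \<and> e z \<le> r}" and lim: "X \<longlonglongrightarrow> l"
    define q S A where "q n = fst (X n)" and "S n = fst (snd (X n))" and "A n = snd (snd (X n))" for n
    have qlim: "q \<longlonglongrightarrow> fst l" and Slim: "S \<longlonglongrightarrow> fst (snd l)" and Alim: "A \<longlonglongrightarrow> snd (snd l)"
      unfolding q_def S_def A_def by (intro tendsto_intros lim)+
    have A: "A n \<noteq> 0" and le: "F * (S n / A n - 1) + (c' * \<bar>F / A n - q n\<bar> + c * \<bar>F / A n - q n\<bar> ^ 3) \<le> r" for n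
      using X[rule_format, of n] by (auto simp: A_def S_def q_def e_def case_prod_unfold)
    obtain Kq KS where K: "\<And>n. \<bar>q n\<bar> \<le> Kq" "\<And>n. \<bar>S n\<bar> \<le> KS"
      using convergent_imp_Bseq[OF convergentI[OF qlim]] convergent_imp_Bseq[OF convergentI[OF Slim]]
      by (auto simp: Bseq_def)
    have K0: "Kq \<ge> 0" "KS \<ge> 0" using K(1,2)[of 0] by linarith+
    define u where "u n = \<bar>F / A n - q n\<bar>" for n
    \<comment> \<open>The maximum bounds \<open>u\<close> through \<open>cubic_growth_bound\<close>,
      after estimating \<open>S * (F / A)\<close> from below by \<open>- KS * (u + Kq)\<close>;
      adding \<open>Kq\<close> passes from \<open>F / A - q\<close> to \<open>F / A\<close>.\<close>
    define B where "B = max 1 ((\<bar>r + F + KS * Kq\<bar> + KS) / c) + Kq"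
    have B: "\<bar>F / A n\<bar> \<le> B" for n
    proof -
      have FA: "\<bar>F / A n\<bar> \<le> u n + Kq" using K(1)[of n] by (simp add: u_def)
      have "\<bar>S n * (F / A n)\<bar> \<le> KS * (u n + Kq)"
        unfolding abs_mult using K(2) FA K0 by (intro mult_mono) auto
      moreover have "S n * (F / A n) - F + c' * u n + c * u n ^ 3 \<le> r"
        using le[of n] by (simp add: u_def algebra_simps)
      moreover have "c' * u n \<ge> 0" using assms(3) by (simp add: u_def)
      moreover have "z \<le> r + F + y" if "\<bar>t\<bar> \<le> y" "t - F + x + z \<le> r" "x \<ge> 0" for t x y z :: real
        using that by linarith
      ultimately have "c * u n ^ 3 \<le> r + F + KS * (u n + Kq)" by blast
      then have "c * u n ^ 3 \<le> (r + F + KS * Kq) + KS * u n" by (simp add: algebra_simps)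
      then have "u n \<le> max 1 ((\<bar>r + F + KS * Kq\<bar> + KS) / c)"
        using K0 assms(2) by (intro cubic_growth_bound) (auto simp: u_def)
      then show ?thesis using FA by (simp add: B_def)
    qed
    have "B > 0" using K0 by (auto simp: B_def intro: add_pos_nonneg)
    have "F / B \<le> \<bar>A n\<bar>" for n
      using B[of n] A[of n] \<open>B > 0\<close> assms(1) by (simp add: abs_divide field_simps)
    then have "F / B \<le> \<bar>snd (snd l)\<bar>"
      by (intro LIMSEQ_le_const[OF tendsto_rabs[OF Alim]]) auto
    then have A0: "snd (snd l) \<noteq> 0" using \<open>B > 0\<close> assms(1) by (smt (verit) divide_pos_pos)
    have "(\<lambda>n. F * (S n / A n - 1) + (c' * \<bar>F / A n - q n\<bar> + c * \<bar>F / A n - q n\<bar> ^ 3)) \<longlonglongrightarrow> e l"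
      unfolding e_def case_prod_unfold by (intro tendsto_intros qlim Slim Alim A0)
    then have "e l \<le> r" using le by (intro LIMSEQ_le_const2) auto
    with A0 show "l \<in> {z. snd (snd z) \<noteq> 0 \<and> e z \<le> r}" by simp
  qed
  ultimately have "closed ({z. snd (snd z) = 0 \<and> - F + (c' * \<bar>fst z\<bar> + c * \<bar>fst z\<bar> ^ 3) \<le> r}
      \<union> {z. snd (snd z) \<noteq> 0 \<and> e z \<le> r})" by (rule closed_Un)
  moreover have "{z. e z \<le> r} = {z. snd (snd z) = 0 \<and> - F + (c' * \<bar>fst z\<bar> + c * \<bar>fst z\<bar> ^ 3) \<le> r}
      \<union> {z. snd (snd z) \<noteq> 0 \<and> e z \<le> r}"
    by (auto simp: e_def)
  ultimately show ?thesis by simp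
qed

section \<open>The dynamic programming recursion for the exponentiated value function\<close>

type_synonym state = "real \<times> real \<times> real"

context asr_model
begin

text \<open>The choice is meaningful for \<open>1 \<le> k \<le> horizon P\<close>, where triviality
  of \<open>filt P 0\<close> provides such a constant.\<close>

definition vconst :: "nat \<Rightarrow> real" where
  "vconst k = (SOME c. AE w in probm P. volume P k w = c)"

text \<open>A single event of full measure on which all the random volumes may be replaced by
  constants.\<close>

definition regular :: "'a \<Rightarrow> bool" where
  "regular w \<longleftrightarrow> (\<forall>k\<in>{1..horizon P}. volume P k w = vconst k)"

lemma AE_vconst: "k \<in> {1..horizon P} \<Longrightarrow> AE w in probm P. volume P k w = vconst k"
  unfolding vconst_def
  by (rule someI_ex, rule AE_constant_of_trivial[OF filt_sub volume_measurable filt_0_trivial])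

lemma AE_regular: "AE w in probm P. regular w"
  unfolding regular_def by (intro AE_ball_countable[THEN iffD2]) (auto intro: AE_vconst)

lemma vconst_pos: "k \<in> {1..horizon P} \<Longrightarrow> vconst k > 0"
proof -
  assume k: "k \<in> {1..horizon P}"
  \<comment> \<open>The claim does not mention the outcome, so in a probability space its holding
    almost surely is its holding.\<close>
  have "AE w in probm P. vconst k > 0"
    using AE_vconst[OF k] volume_pos[OF k] by eventually_elim simp
  then show ?thesis by simp
qed

lemma horizon_pos: "0 < horizon P"
  using exercise_subset exercise_nonempty by fastforce

definition mean_vconst :: real where
  "mean_vconst = (\<Sum>k = 1..horizon P. vconst k) / real (horizon P)"

lemma mean_vconst_pos: "mean_vconst > 0"
  unfolding mean_vconst_def using horizon_pos
  by (intro divide_pos_pos sum_pos vconst_pos) auto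

definition exercise_cost :: "state \<Rightarrow> real" where
  "exercise_cost = (\<lambda>(q, S, A). notional P * (S / A - 1)
     + (cost P (rho_pen P) / rho_pen P * \<bar>notional P / A - q\<bar>
        + risk_av P * (vol P)\<^sup>2 / (6 * rho_pen P * mean_vconst) * \<bar>notional P / A - q\<bar> ^ 3))"

lemma exercise_term_regular: "regular w \<Longrightarrow> exercise_term P w q S A = exercise_cost (q, S, A)"
  by (simp add: exercise_term_def exercise_cost_def penalty_def mean_volume_def mean_vconst_def regular_def)

definition exp_exercise :: "state \<Rightarrow> ennreal" where
  "exp_exercise z = ennreal (exp (risk_av P * exercise_cost z))"

lemma lsc_exp_exercise: "lsc exp_exercise"
  unfolding lsc_def
proof
  fix c
  have cl: "closed {z. exercise_cost z \<le> r}" for r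
    unfolding exercise_cost_def
    using notional_pos mean_vconst_pos risk_av_pos vol_pos rho_pen_pos cost_nonneg
    by (intro closed_exercise_sublevel) auto
  show "closed {z. exp_exercise z \<le> c}"
  proof (cases c)
    case (real s)
    show ?thesis
    proof (cases "s = 0")
      case True
      then show ?thesis using real by (simp add: exp_exercise_def)
    next
      case False
      then have "exp_exercise z \<le> c \<longleftrightarrow> exercise_cost z \<le> ln s / risk_av P" for z
        using real risk_av_pos by (simp add: exp_exercise_def ln_ge_iff[symmetric] field_simps)
      then show ?thesis using cl by simp
    qed
  qed simp
qed

section \<open>One trading period and its cost minimised over the control\<close>

definition next_state :: "nat \<Rightarrow> state \<Rightarrow> real \<Rightarrow> real \<Rightarrow> state" where
  "next_state n z v e =
     (fst z + v * dt P,
      fst (snd z) + vol P * sqrt (dt P) * e,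
      real n / real (Suc n) * snd (snd z) + 1 / real (Suc n) * fst (snd z)
        + 1 / real (Suc n) * vol P * sqrt (dt P) * e)"

text \<open>The factor by which \<open>exp (gamma * (X - q * S))\<close> changes over one period;
  see \<open>weight_Suc\<close>.\<close>

definition step_weight :: "nat \<Rightarrow> state \<Rightarrow> real \<Rightarrow> real \<Rightarrow> real" where
  "step_weight n z v e =
     exp (- risk_av P * (fst z * vol P * sqrt (dt P) * e
            - cost P (v / vconst (Suc n)) * vconst (Suc n) * dt P))"

definition continuation :: "nat \<Rightarrow> (state \<Rightarrow> ennreal) \<Rightarrow> state \<Rightarrow> real \<Rightarrow> ennreal" where
  "continuation n f z v =
     (\<integral>\<^sup>+ w. ennreal (step_weight n z v (noise P (Suc n) w)) * f (next_state n z v (noise P (Suc n) w))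
        \<partial>probm P)"

definition lo :: "nat \<Rightarrow> real" where "lo n = rho_lo P * vconst (Suc n)"
definition hi :: "nat \<Rightarrow> real" where "hi n = rho_hi P * vconst (Suc n)"

definition best_continuation :: "nat \<Rightarrow> (state \<Rightarrow> ennreal) \<Rightarrow> state \<Rightarrow> ennreal" where
  "best_continuation n f z = (INF v\<in>{lo n..hi n}. continuation n f z v)"

lemma lo_le_hi: "n < horizon P \<Longrightarrow> lo n \<le> hi n"
  unfolding lo_def hi_def using vconst_pos[of "Suc n"] rho_le by (intro mult_right_mono) auto

lemma continuous_next_state: "continuous_on UNIV (\<lambda>(z, v, e). next_state n z v e)"
  unfolding next_state_def case_prod_unfold by (intro continuous_intros)

lemma continuous_step_weight:
  assumes "n < horizon P"
  shows "continuous_on UNIV (\<lambda>(z, v, e). step_weight n z v e)"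
proof -
  have "vconst (Suc n) \<noteq> 0" using vconst_pos[of "Suc n"] assms by simp
  then show ?thesis
    unfolding step_weight_def case_prod_unfold
    by (intro continuous_intros continuous_on_compose2[OF cost_continuous]) auto
qed

lemma noise_measurable [measurable]: "n < horizon P \<Longrightarrow> noise P (Suc n) \<in> borel_measurable (probm P)"
  by (rule measurable_from_subalg[OF filt_sub noise_adapted]) auto

lemma continuous_on_next_state [continuous_intros]:
  assumes "continuous_on UNIV s" "continuous_on UNIV u" "continuous_on UNIV e"
  shows "continuous_on UNIV (\<lambda>x. next_state n (s x) (u x) (e x))"
  using continuous_on_compose2[OF continuous_next_state, of UNIV "\<lambda>x. (s x, u x, e x)"] assms
  by (simp add: continuous_on_Pair)

lemma continuous_on_step_weight:
  assumes "n < horizon P"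
    and "continuous_on UNIV s" "continuous_on UNIV u" "continuous_on UNIV e"
  shows "continuous_on UNIV (\<lambda>x. step_weight n (s x) (u x) (e x))"
  using continuous_on_compose2[OF continuous_step_weight[OF assms(1)], of UNIV "\<lambda>x. (s x, u x, e x)"] assms
  by (simp add: continuous_on_Pair)

lemma measurable_continuation_integrand:
  assumes n: "n < horizon P" and f: "f \<in> borel_measurable borel"
  shows "(\<lambda>w. ennreal (step_weight n z v (noise P (Suc n) w)) * f (next_state n z v (noise P (Suc n) w)))
    \<in> borel_measurable (probm P)"
proof -
  have [measurable]: "step_weight n z v \<in> borel_measurable borel" "next_state n z v \<in> borel_measurable borel"
    by (intro borel_measurable_continuous_onI continuous_on_step_weight[OF n] continuous_on_next_state
        continuous_intros)+
  note [measurable] = f noise_measurable[OF n]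
  show ?thesis by measurable
qed

text \<open>Weight and transition are continuous in \<open>(z, v)\<close>, so the integrand is
  jointly lower semicontinuous for each noise value and Fatou passes this to the integral.
  Minimising over \<open>v\<close> relies on this joint form.\<close>

lemma lsc_continuation:
  assumes n: "n < horizon P" and f: "lsc f"
  shows "lsc (\<lambda>(z, v). continuation n f z v)"
  unfolding continuation_def case_prod_unfold
  by (intro lsc_nn_integral lsc_mult lsc_continuous lsc_compose[OF f] continuous_on_step_weight[OF n]
      continuous_intros measurable_continuation_integrand n lsc_borel_measurable f)

lemma lsc_best_continuation: "n < horizon P \<Longrightarrow> lsc f \<Longrightarrow> lsc (best_continuation n f)"
  unfolding best_continuation_def using lo_le_hi
  by (intro lsc_INF_compact lsc_continuation) auto

text \<open>The argument is the number of steps to go until the horizon.\<close>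

primrec exp_value_rev :: "nat \<Rightarrow> state \<Rightarrow> ennreal" where
  "exp_value_rev 0 = exp_exercise"
| "exp_value_rev (Suc m) = (\<lambda>z.
     if horizon P - Suc m \<in> exercise P
     then min (best_continuation (horizon P - Suc m) (exp_value_rev m) z) (exp_exercise z)
     else best_continuation (horizon P - Suc m) (exp_value_rev m) z)"

definition exp_value :: "nat \<Rightarrow> state \<Rightarrow> ennreal" where
  "exp_value n = exp_value_rev (horizon P - n)"

lemma exp_value_horizon: "exp_value (horizon P) = exp_exercise"
  by (simp add: exp_value_def)

lemma exp_value_step:
  assumes "n < horizon P"
  shows "exp_value n z = (if n \<in> exercise P
     then min (best_continuation n (exp_value (Suc n)) z) (exp_exercise z)
     else best_continuation n (exp_value (Suc n)) z)"
proof -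
  have "horizon P - n = Suc (horizon P - Suc n)" using assms by simp
  moreover have "horizon P - Suc (horizon P - Suc n) = n" using assms by simp
  ultimately show ?thesis by (simp add: exp_value_def del: diff_Suc_eq_diff_pred)
qed

lemma lsc_exp_value: "lsc (exp_value n)"
proof -
  \<comment> \<open>The bound on \<open>m\<close> keeps the time index of each recursive step
    strictly below the horizon, where the control interval is nonempty.\<close>
  have "lsc (exp_value_rev m)" if "m \<le> horizon P" for m
    using that
  proof (induction m)
    case (Suc m)
    then have "lsc (best_continuation (horizon P - Suc m) (exp_value_rev m))"
      by (intro lsc_best_continuation) auto
    then show ?case using lsc_exp_exercise
      by (cases "horizon P - Suc m \<in> exercise P") (simp_all add: lsc_min)
  qed (simp add: lsc_exp_exercise)
  then show ?thesis by (simp add: exp_value_def)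
qed

lemma exp_value_le_exercise:
  "n \<in> exercise P \<union> {horizon P} \<Longrightarrow> exp_value n z \<le> exp_exercise z"
  using exercise_subset by (auto simp: exp_value_horizon exp_value_step)

lemma exp_value_le_continuation:
  assumes "n < horizon P" "v \<in> {lo n..hi n}"
  shows "exp_value n z \<le> continuation n (exp_value (Suc n)) z v"
proof -
  have "exp_value n z \<le> best_continuation n (exp_value (Suc n)) z"
    using assms(1) by (simp add: exp_value_step)
  also have "\<dots> \<le> continuation n (exp_value (Suc n)) z v"
    unfolding best_continuation_def by (rule INF_lower[OF assms(2)])
  finally show ?thesis .
qed

section \<open>The controlled state along a strategy\<close>

text \<open>At \<open>k = n\<close> the average is the given one; \<^const>\<open>avg_price\<close> would divide by zero for
  \<open>n = k = 0\<close>.\<close>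

definition state_at ::
    "nat \<Rightarrow> state \<Rightarrow> (nat \<Rightarrow> 'a \<Rightarrow> real) \<Rightarrow> nat \<Rightarrow> 'a \<Rightarrow> state" where
  "state_at n z v k w =
     (inventory P n (fst z) v k w, price P n (fst (snd z)) k w,
      if k = n then snd (snd z) else avg_price P n (snd (snd z)) (fst (snd z)) k w)"

text \<open>This is \<open>exp (gamma * (X - q * S))\<close> started with no cash; initial cash
  \<open>x\<close> contributes only a factor \<open>exp (gamma * x)\<close>, split off in
  \<open>exp_payoff\<close>.\<close>

definition weight ::
    "nat \<Rightarrow> state \<Rightarrow> (nat \<Rightarrow> 'a \<Rightarrow> real) \<Rightarrow> nat \<Rightarrow> 'a \<Rightarrow> real" where
  "weight n z v k w = exp (risk_av P * (cash P n 0 (fst (snd z)) v k w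
     - inventory P n (fst z) v k w * price P n (fst (snd z)) k w))"

lemma state_at_init: "state_at n z v n w = z"
  by (simp add: state_at_def inventory_def price_def)

lemma weight_init: "weight n z v n w = exp (- risk_av P * (fst z * fst (snd z)))"
  by (simp add: weight_def cash_def inventory_def price_def)

lemma price_Suc: "n \<le> k \<Longrightarrow>
    price P n S (Suc k) w = price P n S k w + vol P * sqrt (dt P) * noise P (Suc k) w"
  by (simp add: price_def algebra_simps)

lemma inventory_Suc: "n \<le> k \<Longrightarrow> inventory P n q v (Suc k) w = inventory P n q v k w + v k w * dt P"
  by (simp add: inventory_def)

text \<open>The total \<open>k * A_k\<close> grows by the new price in each period. At
  \<open>k = n = 0\<close> the starting average has coefficient 0.\<close>

lemma avg_price_Suc:
  assumes "n \<le> k"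
  shows "avg_price P n A S (Suc k) w
    = real k / real (Suc k) * (if k = n then A else avg_price P n A S k w)
      + 1 / real (Suc k) * price P n S (Suc k) w"
proof (cases "k = n")
  case False
  then have "real k \<noteq> 0" using assms by simp
  then show ?thesis using False assms by (simp add: avg_price_def add_divide_distrib distrib_left)
qed (simp add: avg_price_def)

lemma state_at_Suc:
  assumes "n \<le> k"
  shows "state_at n z v (Suc k) w = next_state k (state_at n z v k w) (v k w) (noise P (Suc k) w)"
  using assms avg_price_Suc[OF assms, of "snd (snd z)" "fst (snd z)" w]
  by (simp add: state_at_def next_state_def price_Suc inventory_Suc algebra_simps add_divide_distrib)

lemma weight_nonneg: "0 \<le> weight n z v k w"
  by (simp add: weight_def)

text \<open>The amount traded at the new price enters \<open>X\<close> and \<open>q * S\<close>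
  alike and cancels; what remains is the execution cost minus the price gain on the old
  inventory.\<close>

lemma weight_Suc:
  assumes "n \<le> k" "k < horizon P" "regular w"
  shows "weight n z v (Suc k) w
    = weight n z v k w * step_weight k (state_at n z v k w) (v k w) (noise P (Suc k) w)"
proof -
  have V: "volume P (Suc k) w = vconst (Suc k)" using assms by (simp add: regular_def)
  show ?thesis
    unfolding weight_def step_weight_def exp_add[symmetric] using assms(1) V
    by (simp add: state_at_def inventory_Suc price_Suc cash_def algebra_simps)
qed

section \<open>Adaptedness of price, average, inventory, state and weight\<close>

lemma filt_mono: "i \<le> j \<Longrightarrow> f \<in> measurable (filt P i) L \<Longrightarrow> f \<in> measurable (filt P j) L"
  by (erule measurable_from_subalg[rotated]) (simp add: subalgebra_def space_F sets_F_mono)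

lemma measurable_noise_filt: "Suc j \<le> k \<Longrightarrow> k \<le> horizon P \<Longrightarrow> noise P (Suc j) \<in> borel_measurable (filt P k)"
  using filt_mono[of "Suc j" k] noise_adapted[of "Suc j"] by auto

lemma measurable_price: "k \<le> horizon P \<Longrightarrow> i \<le> k \<Longrightarrow> price P n S i \<in> borel_measurable (filt P k)"
  unfolding price_def
  by (intro borel_measurable_add borel_measurable_times borel_measurable_sum borel_measurable_const
      measurable_noise_filt) auto

lemma measurable_avg_price: "k \<le> horizon P \<Longrightarrow> avg_price P n A S k \<in> borel_measurable (filt P k)"
  unfolding avg_price_def
  by (intro borel_measurable_add borel_measurable_times borel_measurable_sum borel_measurable_const
      measurable_price) auto

lemma measurable_inventory:
  assumes "k \<le> horizon P" and "\<And>j. j \<in> {n..<k} \<Longrightarrow> v j \<in> borel_measurable (filt P j)"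
  shows "inventory P n q v k \<in> borel_measurable (filt P k)"
  unfolding inventory_def
  by (intro borel_measurable_add borel_measurable_times borel_measurable_sum borel_measurable_const
      filt_mono[OF _ assms(2)]) auto

lemma measurable_state_at:
  assumes "k \<le> horizon P" and "\<And>j. j \<in> {n..<k} \<Longrightarrow> v j \<in> borel_measurable (filt P j)"
  shows "state_at n z v k \<in> borel_measurable (filt P k)"
  unfolding state_at_def using assms
  by (cases "k = n") (auto intro!: borel_measurable_Pair measurable_inventory measurable_price measurable_avg_price)

lemma measurable_weight:
  assumes k: "k \<le> horizon P" and v: "\<And>j. j \<in> {n..<k} \<Longrightarrow> v j \<in> borel_measurable (filt P j)"
  shows "weight n z v k \<in> borel_measurable (filt P k)"
proof -
  have vk: "v j \<in> borel_measurable (filt P k)" if "j \<in> {n..<k}" for j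
    using that by (intro filt_mono[OF _ v]) auto
  have vol: "volume P (Suc j) \<in> borel_measurable (filt P k)" if "j \<in> {n..<k}" for j
    using that k by (intro filt_mono[OF _ volume_measurable]) auto
  have cost: "cost P \<in> borel_measurable borel"
    by (rule borel_measurable_continuous_onI[OF cost_continuous])
  have "cash P n 0 (fst (snd z)) v k \<in> borel_measurable (filt P k)"
    unfolding cash_def using k
    by (intro borel_measurable_add borel_measurable_times borel_measurable_sum borel_measurable_const
      vk vol measurable_price measurable_compose[OF _ cost] borel_measurable_divide) auto
  then show ?thesis
    unfolding weight_def
    by (intro measurable_compose[OF _ borel_measurable_exp] borel_measurable_times borel_measurable_diff
        borel_measurable_const measurable_inventory measurable_price k v) auto
qed

text \<open>Since \<open>F - (F / A) * S = - F * (S / A - 1)\<close>, the payoff regroups as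
  \<open>- (X - q * S)\<close> minus the exercise cost, and the exponential factorises.\<close>

lemma exp_payoff:
  assumes "regular w" and "n \<le> T w" and "0 < T w"
  shows "exp (- risk_av P * payoff P n x q S A v T w)
    = exp (risk_av P * x) * (weight n (q, S, A) v (T w) w
        * exp (risk_av P * exercise_cost (state_at n (q, S, A) v (T w) w)))"
proof -
  let ?k = "T w"
  define Q S' A' where "Q = inventory P n q v ?k w" and "S' = price P n S ?k w"
    and "A' = avg_price P n A S ?k w"
  \<comment> \<open>The hypothesis \<open>0 < T w\<close> rules out the division by zero in
    \<open>avg_price\<close>, so stopping at once uses the given average.\<close>
  have "avg_price P n A S n w = A" if "?k = n" using that assms(3) by (simp add: avg_price_def)
  then have "state_at n (q, S, A) v ?k w = (Q, S', A')"
    by (auto simp: state_at_def Q_def S'_def A'_def)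
  then have ex: "exercise_cost (state_at n (q, S, A) v ?k w) = exercise_term P w Q S' A'"
    using exercise_term_regular[OF assms(1)] by simp
  have cash: "cash P n x S v ?k w = x + cash P n 0 S v ?k w" by (simp add: cash_def)
  show ?thesis
    unfolding ex exp_add[symmetric] weight_def payoff_def exercise_term_def cash
      Q_def[symmetric] S'_def[symmetric] A'_def[symmetric] fst_conv snd_conv
    by (simp add: algebra_simps)
qed

text \<open>The next noise is independent of \<open>filt P k\<close>, while the rest of the
  integrand, including the indicator of \<open>B\<close>, is known at time \<open>k\<close> and can
  be frozen. This plays the part of conditioning on \<open>filt P k\<close>.\<close>

lemma one_step:
  assumes nk: "n \<le> k" "k < horizon P"
    and v: "\<And>j. j \<in> {n..k} \<Longrightarrow> v j \<in> borel_measurable (filt P j)"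
    and B: "B \<in> sets (filt P k)" and f: "f \<in> borel_measurable borel"
  shows "(\<integral>\<^sup>+ w. ennreal (weight n z v (Suc k) w) * f (state_at n z v (Suc k) w) * indicator B w \<partial>probm P)
    = (\<integral>\<^sup>+ w. ennreal (weight n z v k w) * continuation k f (state_at n z v k w) (v k w) * indicator B w
        \<partial>probm P)"
proof -
  define H where "H = (\<lambda>(d :: ennreal, s, u) e.
     d * (ennreal (step_weight k s u e) * f (next_state k s u e)))"
  define Y where "Y w = (ennreal (weight n z v k w) * indicator B w, state_at n z v k w, v k w)" for w
  have [measurable]:
    "(\<lambda>p :: (ennreal \<times> state \<times> real) \<times> real.
        step_weight k (fst (snd (fst p))) (snd (snd (fst p))) (snd p)) \<in> borel_measurable borel"
    "(\<lambda>p :: (ennreal \<times> state \<times> real) \<times> real.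
        next_state k (fst (snd (fst p))) (snd (snd (fst p))) (snd p)) \<in> borel_measurable borel"
    "(\<lambda>p :: (ennreal \<times> state \<times> real) \<times> real. fst (fst p)) \<in> borel_measurable borel"
    by (intro borel_measurable_continuous_onI continuous_on_step_weight nk continuous_intros)+
  have H: "(\<lambda>(y, e). H y e) \<in> borel_measurable (borel \<Otimes>\<^sub>M borel)"
    unfolding H_def case_prod_unfold borel_prod using f by measurable
  have Y: "Y \<in> borel_measurable (filt P k)"
    unfolding Y_def using nk v B
    by (intro borel_measurable_Pair borel_measurable_times_ennreal measurable_compose[OF _ measurable_ennreal]
      measurable_weight measurable_state_at borel_measurable_indicator) auto
  have "(\<integral>\<^sup>+ w. ennreal (weight n z v (Suc k) w) * f (state_at n z v (Suc k) w) * indicator B w \<partial>probm P)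
      = (\<integral>\<^sup>+ w. H (Y w) (noise P (Suc k) w) \<partial>probm P)"
    using AE_regular
    by (intro nn_integral_cong_AE, elim eventually_mono)
      (simp add: H_def Y_def weight_Suc state_at_Suc nk ennreal_mult' weight_nonneg mult_ac)
  also have "\<dots> = (\<integral>\<^sup>+ w. \<integral>\<^sup>+ w'. H (Y w) (noise P (Suc k) w') \<partial>probm P \<partial>probm P)"
    using nk by (intro nn_integral_indep_freeze[OF filt_sub Y _ noise_indep_filt H] noise_measurable)
  also have "\<dots> = (\<integral>\<^sup>+ w. ennreal (weight n z v k w) * continuation k f (state_at n z v k w) (v k w) * indicator B w
        \<partial>probm P)"
  proof (rule nn_integral_cong)
    fix w
    show "(\<integral>\<^sup>+ w'. H (Y w) (noise P (Suc k) w') \<partial>probm P)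
      = ennreal (weight n z v k w) * continuation k f (state_at n z v k w) (v k w) * indicator B w"
      by (simp add: H_def Y_def continuation_def nn_integral_cmult[OF measurable_continuation_integrand[OF nk(2) f]])
        (simp add: mult_ac)
  qed
  finally show ?thesis .
qed

section \<open>Verification\<close>

text \<open>Slicing by the value of \<open>T\<close> replaces the stopping time by finitely many
  deterministic times.\<close>

definition stop_cost :: "nat \<Rightarrow> state \<Rightarrow> (nat \<Rightarrow> 'a \<Rightarrow> real) \<Rightarrow> ('a \<Rightarrow> nat) \<Rightarrow> nat \<Rightarrow> ennreal" where
  "stop_cost n z v T k = (\<integral>\<^sup>+ w. ennreal (weight n z v k w) * exp_exercise (state_at n z v k w)
     * indicator {w \<in> space (probm P). T w = k} w \<partial>probm P)"

definition value_at :: "nat \<Rightarrow> state \<Rightarrow> (nat \<Rightarrow> 'a \<Rightarrow> real) \<Rightarrow> nat \<Rightarrow> 'a set \<Rightarrow> ennreal" where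
  "value_at n z v k B =
     (\<integral>\<^sup>+ w. ennreal (weight n z v k w) * exp_value k (state_at n z v k w) * indicator B w \<partial>probm P)"

lemma admissibleD:
  assumes "(v, T) \<in> admissible P n"
  shows "stopping_time (filt P) T"
    and "w \<in> space (probm P) \<Longrightarrow> T w \<in> exercise P \<union> {horizon P} \<and> n \<le> T w \<and> T w \<le> horizon P \<and> 0 < T w"
    and "k \<in> {n..<horizon P} \<Longrightarrow> v k \<in> borel_measurable (filt P k)"
    and "AE w in probm P. \<forall>k\<in>{n..<T w}. v k w \<in> {lo k..hi k}"
proof -
  note a = assms[unfolded admissible_def mem_Collect_eq case_prod_conv]
  show "stopping_time (filt P) T" and "k \<in> {n..<horizon P} \<Longrightarrow> v k \<in> borel_measurable (filt P k)"
    using a by auto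
  show T: "T w \<in> exercise P \<union> {horizon P} \<and> n \<le> T w \<and> T w \<le> horizon P \<and> 0 < T w"
    if "w \<in> space (probm P)" for w
    using a that exercise_subset horizon_pos by fastforce
  have "AE w in probm P. \<forall>k\<in>{n..<T w}. rho_lo P * volume P (Suc k) w \<le> v k w \<and> v k w \<le> rho_hi P * volume P (Suc k) w"
    using a by blast
  then show "AE w in probm P. \<forall>k\<in>{n..<T w}. v k w \<in> {lo k..hi k}"
    using AE_regular AE_space
  proof eventually_elim
    case (elim w)
    then have "volume P (Suc k) w = vconst (Suc k)" if "k \<in> {n..<T w}" for k
      using that T[of w] by (auto simp: regular_def)
    then show ?case using elim by (auto simp: lo_def hi_def)
  qed
qed

lemma stopping_sets:
  assumes "stopping_time (filt P) T"
  shows "{w \<in> space (probm P). k < T w} \<in> sets (filt P k)"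
    and "{w \<in> space (probm P). k < T w} \<in> sets (probm P)"
    and "{w \<in> space (probm P). T w = k} \<in> sets (probm P)"
proof -
  have *: "{w \<in> space (probm P). k < T w} \<in> sets (filt P k)" for k
    using stopping_timeD2[OF assms, of k] by (simp add: pred_def space_F)
  have **: "{w \<in> space (probm P). k < T w} \<in> sets (probm P)" for k
    using *[of k] filt_sub[of k] by (auto simp: subalgebra_def)
  show "{w \<in> space (probm P). k < T w} \<in> sets (filt P k)" by (rule *)
  show "{w \<in> space (probm P). k < T w} \<in> sets (probm P)" by (rule **)
  have T: "T \<in> borel_measurable (probm P)"
    using filt_sub by (intro measurable_stopping_time[OF assms]) (auto simp: subalgebra_def)
  then show "{w \<in> space (probm P). T w = k} \<in> sets (probm P)"
    by measurable
qed

lemma measurable_weighted: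
  assumes "\<And>j. j \<in> {n..<horizon P} \<Longrightarrow> v j \<in> borel_measurable (filt P j)" and "k \<le> horizon P"
    and f: "f \<in> borel_measurable borel"
  shows "(\<lambda>w. ennreal (weight n z v k w) * f (state_at n z v k w)) \<in> borel_measurable (probm P)"
proof -
  have [measurable]: "weight n z v k \<in> borel_measurable (probm P)" "state_at n z v k \<in> borel_measurable (probm P)"
    using assms by (auto intro!: measurable_from_subalg[OF filt_sub[of k]] measurable_weight measurable_state_at)
  show ?thesis using f by measurable
qed

lemma expected_exp_payoff:
  assumes adm: "(v, T) \<in> admissible P n"
  shows "(\<integral>\<^sup>+ w. ennreal (exp (- risk_av P * payoff P n x q S A v T w)) \<partial>probm P)
    = ennreal (exp (risk_av P * x)) * (\<Sum>k = n..horizon P. stop_cost n (q, S, A) v T k)"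
proof -
  note D = admissibleD[OF adm]
  let ?g = "\<lambda>k w. ennreal (weight n (q, S, A) v k w) * exp_exercise (state_at n (q, S, A) v k w)
    * indicator {w \<in> space (probm P). T w = k} w"
  have meas: "?g k \<in> borel_measurable (probm P)" if "k \<le> horizon P" for k
    by (rule borel_measurable_times_ennreal[OF measurable_weighted borel_measurable_indicator])
      (auto intro: D that lsc_borel_measurable lsc_exp_exercise stopping_sets)
  have "(\<integral>\<^sup>+ w. ennreal (exp (- risk_av P * payoff P n x q S A v T w)) \<partial>probm P)
     = (\<integral>\<^sup>+ w. ennreal (exp (risk_av P * x)) * (\<Sum>k = n..horizon P. ?g k w) \<partial>probm P)"
  proof (rule nn_integral_cong_AE)
    show "AE w in probm P. ennreal (exp (- risk_av P * payoff P n x q S A v T w))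
      = ennreal (exp (risk_av P * x)) * (\<Sum>k = n..horizon P. ?g k w)"
      using AE_regular AE_space
    proof eventually_elim
      case (elim w)
      note Tw = D(2)[OF elim(2)]
      \<comment> \<open>Of the events \<open>T w = k\<close> only the one with
        \<open>k = T w\<close> occurs, and this index lies in the range of summation.\<close>
      have "(\<Sum>k = n..horizon P. ?g k w) = (\<Sum>k\<in>{T w}. ?g k w)"
        using Tw elim by (intro sum.mono_neutral_right) auto
      also have "\<dots> = ennreal (weight n (q, S, A) v (T w) w) * exp_exercise (state_at n (q, S, A) v (T w) w)"
        using elim by simp
      finally have sum: "(\<Sum>k = n..horizon P. ?g k w)
        = ennreal (weight n (q, S, A) v (T w) w) * exp_exercise (state_at n (q, S, A) v (T w) w)" .
      have "n \<le> T w" "0 < T w" using Tw by auto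
      then show ?case
        unfolding sum exp_payoff[where T = T, OF elim(1) \<open>n \<le> T w\<close> \<open>0 < T w\<close>]
        by (simp add: exp_exercise_def ennreal_mult' weight_nonneg)
    qed
  qed
  also have "\<dots> = ennreal (exp (risk_av P * x)) * (\<Sum>k = n..horizon P. stop_cost n (q, S, A) v T k)"
    unfolding stop_cost_def
    by (subst nn_integral_cmult, intro borel_measurable_sum meas, simp)
      (intro arg_cong2[of _ _ _ _ "(*)"] refl nn_integral_sum meas, simp)
  finally show ?thesis .
qed

lemma value_at_split:
  assumes "stopping_time (filt P) T"
    and "\<And>j. j \<in> {n..<horizon P} \<Longrightarrow> v j \<in> borel_measurable (filt P j)" and "k \<le> horizon P"
    and "\<And>w. w \<in> space (probm P) \<Longrightarrow> B w \<longleftrightarrow> k \<le> T w"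
  shows "value_at n z v k {w \<in> space (probm P). B w}
    = value_at n z v k {w \<in> space (probm P). T w = k} + value_at n z v k {w \<in> space (probm P). k < T w}"
proof -
  note m = measurable_weighted[OF assms(2,3) lsc_borel_measurable[OF lsc_exp_value]]
  have "value_at n z v k {w \<in> space (probm P). B w}
    = (\<integral>\<^sup>+ w. ennreal (weight n z v k w) * exp_value k (state_at n z v k w) * indicator {w \<in> space (probm P). T w = k} w
       + ennreal (weight n z v k w) * exp_value k (state_at n z v k w) * indicator {w \<in> space (probm P). k < T w} w
       \<partial>probm P)"
    unfolding value_at_def using assms(4)
    by (intro nn_integral_cong) (auto simp: indicator_def)
  then show ?thesis
    unfolding value_at_def using stopping_sets[OF assms(1)] m
    by (subst (asm) nn_integral_add) (auto intro!: borel_measurable_times_ennreal)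
qed

text \<open>Not having stopped by time \<open>k\<close> is an event of \<open>filt P k\<close> and
  coincides with \<open>Suc k \<le> T\<close>; so it stays fixed while \<open>one_step\<close>
  integrates out the next noise, and the induction hypothesis at \<open>Suc k\<close> applies to
  it.\<close>

lemma value_at_Suc:
  assumes "n \<le> k" "k < horizon P" and "stopping_time (filt P) T"
    and v: "\<And>j. j \<in> {n..<horizon P} \<Longrightarrow> v j \<in> borel_measurable (filt P j)"
  shows "value_at n z v (Suc k) {w \<in> space (probm P). k < T w}
    = (\<integral>\<^sup>+ w. ennreal (weight n z v k w) * continuation k (exp_value (Suc k)) (state_at n z v k w) (v k w)
        * indicator {w \<in> space (probm P). k < T w} w \<partial>probm P)"
  unfolding value_at_def using assms
  by (intro one_step lsc_borel_measurable lsc_exp_value stopping_sets) auto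

text \<open>Backward induction on \<open>k\<close>. Where \<open>T = k\<close>, the value is at most
  the exercise cost; where \<open>k < T\<close>, the admissible control costs at least the minimal
  continuation.\<close>

lemma value_at_le_stop_cost:
  assumes adm: "(v, T) \<in> admissible P n" and "n \<le> k" "k \<le> horizon P"
  shows "value_at n z v k {w \<in> space (probm P). k \<le> T w} \<le> (\<Sum>j = k..horizon P. stop_cost n z v T j)"
  using assms(3,2)
proof (induction k rule: inc_induct)
  note D = admissibleD[OF adm]
  {
    fix k
    have "value_at n z v k {w \<in> space (probm P). T w = k} \<le> stop_cost n z v T k"
      unfolding value_at_def stop_cost_def using D(2)
      by (intro nn_integral_mono) (auto intro!: mult_left_mono exp_value_le_exercise split: split_indicator)
  } note stop = this
  {
    case base
    have "value_at n z v (horizon P) {w \<in> space (probm P). horizon P \<le> T w}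
        = value_at n z v (horizon P) {w \<in> space (probm P). T w = horizon P}"
      using D(2) by (intro arg_cong[of _ _ "value_at n z v (horizon P)"]) force
    then show ?case using stop[of "horizon P"] by simp
  }
  {
    case (step k)
    have Suc_eq: "value_at n z v (Suc k) {w \<in> space (probm P). k < T w}
      = (\<integral>\<^sup>+ w. ennreal (weight n z v k w) * continuation k (exp_value (Suc k)) (state_at n z v k w) (v k w)
          * indicator {w \<in> space (probm P). k < T w} w \<partial>probm P)"
      using step by (intro value_at_Suc D(1,3)) auto
    have "value_at n z v k {w \<in> space (probm P). k < T w} \<le> value_at n z v (Suc k) {w \<in> space (probm P). k < T w}"
      unfolding Suc_eq value_at_def[of _ _ _ k]
    proof (rule nn_integral_mono_AE)
      show "AE w in probm P. ennreal (weight n z v k w) * exp_value k (state_at n z v k w) *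
            indicator {w \<in> space (probm P). k < T w} w
            \<le> ennreal (weight n z v k w) * continuation k (exp_value (Suc k)) (state_at n z v k w) (v k w) *
              indicator {w \<in> space (probm P). k < T w} w"
        using D(4)
        by eventually_elim
          (use step in \<open>auto intro!: mult_left_mono exp_value_le_continuation split: split_indicator\<close>)
    qed
    moreover have "value_at n z v k {w \<in> space (probm P). k \<le> T w}
        = value_at n z v k {w \<in> space (probm P). T w = k} + value_at n z v k {w \<in> space (probm P). k < T w}"
      using step by (intro value_at_split D(1,3)) auto
    ultimately show ?case
      using step add_mono[OF stop[of k] order_trans[OF _ step.IH]]
      by (simp add: sum.atLeast_Suc_atMost Suc_le_eq)
  }
qed

text \<open>The same backward induction with both inequalities reversed: the two hypotheses say that
  the strategy stops only where exercising is optimal and trades with a minimising control until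
  then.\<close>

lemma stop_cost_le_value_at:
  assumes adm: "(v, T) \<in> admissible P n" and "n \<le> k" "k \<le> horizon P"
    and stop_opt: "\<And>w. w \<in> space (probm P) \<Longrightarrow>
      exp_exercise (state_at n z v (T w) w) \<le> exp_value (T w) (state_at n z v (T w) w)"
    and trade_opt: "\<And>w k. w \<in> space (probm P) \<Longrightarrow> n \<le> k \<Longrightarrow> k < T w \<Longrightarrow>
      continuation k (exp_value (Suc k)) (state_at n z v k w) (v k w) \<le> exp_value k (state_at n z v k w)"
  shows "(\<Sum>j = k..horizon P. stop_cost n z v T j) \<le> value_at n z v k {w \<in> space (probm P). k \<le> T w}"
  using assms(3,2)
proof (induction k rule: inc_induct)
  note D = admissibleD[OF adm]
  {
    fix k
    have "stop_cost n z v T k \<le> value_at n z v k {w \<in> space (probm P). T w = k}"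
      unfolding value_at_def stop_cost_def using stop_opt
      by (intro nn_integral_mono) (auto intro!: mult_left_mono split: split_indicator)
  } note stop = this
  {
    case base
    have "value_at n z v (horizon P) {w \<in> space (probm P). horizon P \<le> T w}
        = value_at n z v (horizon P) {w \<in> space (probm P). T w = horizon P}"
      using D(2) by (intro arg_cong[of _ _ "value_at n z v (horizon P)"]) force
    then show ?case using stop[of "horizon P"] by simp
  }
  {
    case (step k)
    have Suc_eq: "value_at n z v (Suc k) {w \<in> space (probm P). k < T w}
      = (\<integral>\<^sup>+ w. ennreal (weight n z v k w) * continuation k (exp_value (Suc k)) (state_at n z v k w) (v k w)
          * indicator {w \<in> space (probm P). k < T w} w \<partial>probm P)"
      using step by (intro value_at_Suc D(1,3)) auto
    have "value_at n z v (Suc k) {w \<in> space (probm P). k < T w} \<le> value_at n z v k {w \<in> space (probm P). k < T w}"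
      unfolding Suc_eq value_at_def[of _ _ _ k]
      using step.prems trade_opt
      by (intro nn_integral_mono) (auto intro!: mult_left_mono split: split_indicator)
    moreover have "value_at n z v k {w \<in> space (probm P). k \<le> T w}
        = value_at n z v k {w \<in> space (probm P). T w = k} + value_at n z v k {w \<in> space (probm P). k < T w}"
      using step by (intro value_at_split D(1,3)) auto
    ultimately show ?case
      using step add_mono[OF stop[of k] order_trans[OF step.IH]]
      by (simp add: sum.atLeast_Suc_atMost Suc_le_eq)
  }
qed

lemma value_at_init:
  assumes "(v, T) \<in> admissible P n"
  shows "value_at n z v n {w \<in> space (probm P). n \<le> T w}
    = ennreal (exp (- risk_av P * (fst z * fst (snd z)))) * exp_value n z"
proof -
  have "{w \<in> space (probm P). n \<le> T w} = space (probm P)"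
    using admissibleD(2)[OF assms] by auto
  then show ?thesis
    by (simp add: value_at_def weight_init state_at_init nn_integral_cmult_indicator emeasure_space_1)
qed

text \<open>Use Borel minimisers as feedback and stop the first time exercising costs no more than
  continuing; the two hypotheses of \<open>stop_cost_le_value_at\<close> then hold by
  construction.\<close>

lemma optimal_strategy:
  assumes n: "n \<le> horizon P"
  shows "\<exists>v T. (v, T) \<in> admissible P n \<and>
    (\<Sum>j = n..horizon P. stop_cost n z v T j) \<le> ennreal (exp (- risk_av P * (fst z * fst (snd z)))) * exp_value n z"
proof -
  have "\<exists>s\<in>borel_measurable borel. \<forall>y. s y \<in> {lo k..hi k} \<and>
      continuation k (exp_value (Suc k)) y (s y) = best_continuation k (exp_value (Suc k)) y"
    if "k < horizon P" for k
    unfolding best_continuation_def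
    using lsc_measurable_minimiser[OF lsc_continuation[OF that lsc_exp_value] lo_le_hi[OF that]] .
  then obtain s where s: "\<And>k. k < horizon P \<Longrightarrow> s k \<in> borel_measurable borel"
    "\<And>k y. k < horizon P \<Longrightarrow> s k y \<in> {lo k..hi k}"
    "\<And>k y. k < horizon P \<Longrightarrow>
      continuation k (exp_value (Suc k)) y (s k y) = best_continuation k (exp_value (Suc k)) y"
    by metis
  \<comment> \<open>The control depends on the state and the state on earlier controls. Running the
    closed loop first, without \<open>v\<close>, breaks the circle; \<open>state_at\<close> along
    \<open>v\<close> is identified with \<open>Z\<close> afterwards. Up to time \<open>n\<close> the
    path is held at \<open>z\<close>.\<close>
  define Z where "Z = rec_nat (\<lambda>w. z) (\<lambda>k Zk w. if k < n then z else
    next_state k (Zk w) (s k (Zk w)) (noise P (Suc k) w))"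
  have Z_Suc: "n \<le> k \<Longrightarrow> Z (Suc k) w = next_state k (Z k w) (s k (Z k w)) (noise P (Suc k) w)" for k w
    by (simp add: Z_def)
  have Z_n: "Z n = (\<lambda>w. z)"
    by (cases n) (simp_all add: Z_def)
  define v where "v k w = s k (Z k w)" for k w
  have Z: "state_at n z v k w = Z k w" if "n \<le> k" for k w
    using that by (induction k rule: dec_induct) (simp_all add: state_at_init Z_n state_at_Suc Z_Suc v_def)
  have Z_meas: "Z k \<in> borel_measurable (filt P k)" if "n \<le> k" "k \<le> horizon P" for k
    using that
  proof (induction k rule: dec_induct)
    case base
    then show ?case by (simp add: Z_n)
  next
    case (step k)
    have next_meas: "(\<lambda>p :: state \<times> real \<times> real. next_state k (fst p) (fst (snd p)) (snd (snd p)))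
        \<in> borel_measurable borel"
      by (intro borel_measurable_continuous_onI continuous_intros)
    have "Z k \<in> borel_measurable (filt P (Suc k))"
      using step by (intro filt_mono[of k "Suc k"]) auto
    then have "(\<lambda>w. (Z k w, s k (Z k w), noise P (Suc k) w)) \<in> borel_measurable (filt P (Suc k))"
      using step by (intro borel_measurable_Pair measurable_compose[OF _ s(1)] noise_adapted) auto
    from measurable_compose[OF this next_meas]
    have "(\<lambda>w. next_state k (Z k w) (s k (Z k w)) (noise P (Suc k) w)) \<in> borel_measurable (filt P (Suc k))"
      by simp
    moreover have "Z (Suc k) = (\<lambda>w. next_state k (Z k w) (s k (Z k w)) (noise P (Suc k) w))"
      using Z_Suc step by auto
    ultimately show ?case by simp
  qed
  have v_meas: "v k \<in> borel_measurable (filt P k)" if "k \<in> {n..<horizon P}" for k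
    unfolding v_def using that by (intro measurable_compose[OF Z_meas s(1)]) auto
  define stop where "stop k w \<longleftrightarrow> n \<le> k \<and> (k = horizon P \<or>
      k \<in> exercise P \<and> exp_exercise (Z k w) \<le> best_continuation k (exp_value (Suc k)) (Z k w))" for k w
  define T where "T w = (LEAST k. stop k w)" for w
  \<comment> \<open>The horizon always qualifies, so the least stopping index exists and does not
    exceed it.\<close>
  have stop_N: "stop (horizon P) w" for w using n by (simp add: stop_def)
  have stop_T: "stop (T w) w" for w unfolding T_def by (rule LeastI) (rule stop_N)
  have T_le: "T w \<le> k" if "stop k w" for k w unfolding T_def using that by (rule Least_le)
  have T_iff: "T w \<le> t \<longleftrightarrow> (\<exists>k\<in>{..t}. stop k w)" for t w
    using T_le stop_T by (meson atMost_iff order_trans)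
  have stop_meas: "Measurable.pred (filt P t) (stop k)" if "k \<le> t" for k t
  proof (cases "n \<le> k \<and> k < horizon P")
    case True
    then have Zk: "Z k \<in> borel_measurable (filt P t)"
      using that by (intro filt_mono[OF that] Z_meas) auto
    have "(\<lambda>w. exp_exercise (Z k w)) \<in> borel_measurable (filt P t)"
      by (rule measurable_compose[OF Zk lsc_borel_measurable[OF lsc_exp_exercise]])
    moreover have "(\<lambda>w. best_continuation k (exp_value (Suc k)) (Z k w)) \<in> borel_measurable (filt P t)"
      using True
      by (intro measurable_compose[OF Zk] lsc_borel_measurable lsc_best_continuation lsc_exp_value) auto
    ultimately have "{w \<in> space (filt P t). exp_exercise (Z k w)
        \<le> best_continuation k (exp_value (Suc k)) (Z k w)} \<in> sets (filt P t)"
      by (rule borel_measurable_le)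
    moreover have "stop k w \<longleftrightarrow> k \<in> exercise P \<and>
        exp_exercise (Z k w) \<le> best_continuation k (exp_value (Suc k)) (Z k w)" for w
      using True by (auto simp: stop_def)
    ultimately show ?thesis by (cases "k \<in> exercise P") (simp_all add: pred_def)
  next
    case False
    then have "stop k w \<longleftrightarrow> n \<le> k \<and> k = horizon P" for w
      using exercise_subset by (auto simp: stop_def)
    then show ?thesis by (simp add: pred_def)
  qed
  have "stopping_time (filt P) T"
  proof
    fix t
    show "Measurable.pred (filt P t) (\<lambda>w. T w \<le> t)"
      unfolding T_iff by (intro pred_intros_finite stop_meas) auto
  qed
  moreover have "T w \<in> (exercise P \<union> {horizon P}) \<inter> {n..horizon P}" for w
    using stop_T[of w] T_le[OF stop_N, of w] by (auto simp: stop_def)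
  moreover have "AE w in probm P. \<forall>k\<in>{n..<T w}. rho_lo P * volume P (Suc k) w \<le> v k w \<and> v k w \<le> rho_hi P * volume P (Suc k) w"
    using AE_regular
  proof eventually_elim
    case (elim w)
    have "v k w \<in> {lo k..hi k}" "volume P (Suc k) w = vconst (Suc k)" if "k \<in> {n..<T w}" for k
      using that T_le[OF stop_N, of w] elim s(2)[of k "Z k w"] by (auto simp: v_def regular_def)
    then show ?case by (auto simp: lo_def hi_def)
  qed
  ultimately have adm: "(v, T) \<in> admissible P n"
    using v_meas by (auto simp: admissible_def)
  have "(\<Sum>j = n..horizon P. stop_cost n z v T j) \<le> value_at n z v n {w \<in> space (probm P). n \<le> T w}"
  proof (rule stop_cost_le_value_at[OF adm order_refl n])
    fix w
    show "exp_exercise (state_at n z v (T w) w) \<le> exp_value (T w) (state_at n z v (T w) w)"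
      using stop_T[of w] exercise_subset
      by (auto simp: stop_def Z exp_value_horizon exp_value_step)
    show "continuation k (exp_value (Suc k)) (state_at n z v k w) (v k w) \<le> exp_value k (state_at n z v k w)"
      if "n \<le> k" "k < T w" for k
    proof -
      have "k < horizon P" using that T_le[OF stop_N, of w] by simp
      \<comment> \<open>Before \<open>T\<close>, exercising is either not allowed or strictly dearer
        than continuing, so \<open>exp_value\<close> is the minimal continuation cost, attained by
        \<open>s k\<close>.\<close>
      moreover have "\<not> stop k w" using that T_le[of k w] by auto
      ultimately show ?thesis
        using that by (auto simp: stop_def Z exp_value_step v_def s(3))
    qed
  qed
  then show ?thesis using adm value_at_init[OF adm] by metis
qed

text \<open>The supremum of the negated costs is a maximum: \<open>value_at_le_stop_cost\<close>
  bounds every strategy and \<open>optimal_strategy\<close> attains the bound.\<close>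

lemma value_fn_eq:
  assumes n: "n \<le> horizon P"
  shows "value_fn P n x q S A
    = - enn2ereal (ennreal (exp (risk_av P * (x - q * S))) * exp_value n (q, S, A))"
proof -
  let ?W = "ennreal (exp (- risk_av P * (q * S))) * exp_value n (q, S, A)"
  have W: "ennreal (exp (risk_av P * (x - q * S))) * exp_value n (q, S, A) = ennreal (exp (risk_av P * x)) * ?W"
    unfolding mult.assoc[symmetric] by (simp add: ennreal_mult'[symmetric] exp_add[symmetric] algebra_simps)
  have "value_fn P n x q S A = (SUP (v, T)\<in>admissible P n.
      - enn2ereal (ennreal (exp (risk_av P * x)) * (\<Sum>k = n..horizon P. stop_cost n (q, S, A) v T k)))"
    unfolding value_fn_def by (intro SUP_cong refl) (auto simp: expected_exp_payoff[symmetric])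
  also have "\<dots> = - enn2ereal (ennreal (exp (risk_av P * x)) * ?W)"
  proof (rule antisym)
    show "(SUP (v, T)\<in>admissible P n.
        - enn2ereal (ennreal (exp (risk_av P * x)) * (\<Sum>k = n..horizon P. stop_cost n (q, S, A) v T k)))
      \<le> - enn2ereal (ennreal (exp (risk_av P * x)) * ?W)"
    proof (intro SUP_least, clarify)
      fix v T assume adm: "(v, T) \<in> admissible P n"
      have "?W \<le> (\<Sum>k = n..horizon P. stop_cost n (q, S, A) v T k)"
        using value_at_le_stop_cost[OF adm order_refl n, of "(q, S, A)"] value_at_init[OF adm, of "(q, S, A)"]
        by simp
      then show "- enn2ereal (ennreal (exp (risk_av P * x)) * (\<Sum>k = n..horizon P. stop_cost n (q, S, A) v T k))
        \<le> - enn2ereal (ennreal (exp (risk_av P * x)) * ?W)"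
        by (simp add: mult_left_mono less_eq_ennreal.rep_eq[symmetric] ereal_minus_le_minus)
    qed
    obtain v T where vT: "(v, T) \<in> admissible P n" "(\<Sum>j = n..horizon P. stop_cost n (q, S, A) v T j) \<le> ?W"
      using optimal_strategy[OF n, of "(q, S, A)"] by auto
    have "- enn2ereal (ennreal (exp (risk_av P * x)) * ?W)
      \<le> - enn2ereal (ennreal (exp (risk_av P * x)) * (\<Sum>k = n..horizon P. stop_cost n (q, S, A) v T k))"
      using vT(2) by (simp add: mult_left_mono less_eq_ennreal.rep_eq[symmetric] ereal_minus_le_minus)
    then show "- enn2ereal (ennreal (exp (risk_av P * x)) * ?W) \<le> (SUP (v, T)\<in>admissible P n.
        - enn2ereal (ennreal (exp (risk_av P * x)) * (\<Sum>k = n..horizon P. stop_cost n (q, S, A) v T k)))"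
      by (intro SUP_upper2[OF vT(1)]) simp
  qed
  finally show ?thesis by (simp only: W)
qed

end

section \<open>Passing to logarithms\<close>

lemma ln_exp_ereal: "ln_ennreal (exp_ereal t) = t"
  by (cases t) (auto simp: ln_ennreal_def exp_ereal_def)

lemma exp_ln_ennreal: "exp_ereal (ln_ennreal y) = y"
  by (cases y) (auto simp: ln_ennreal_def exp_ereal_def)

lemma ln_ennreal_mono: "y \<le> y' \<Longrightarrow> ln_ennreal y \<le> ln_ennreal y'"
  by (cases y; cases y') (auto simp: ln_ennreal_def top_unique)

text \<open>The finite shift \<open>r\<close> never meets an opposite infinity and its exponential
  is positive and finite, so the identity persists for infinite \<open>t\<close>.\<close>

lemma exp_ereal_affine:
  assumes "c > 0"
  shows "exp_ereal (ereal (- c) * (ereal r - t)) = ennreal (exp (- c * r)) * exp_ereal (ereal c * t)"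
  using assms
  by (cases t) (auto simp: exp_ereal_def ennreal_mult'[symmetric] exp_add[symmetric] algebra_simps ennreal_mult_top)

context asr_model
begin

text \<open>The inverse of \<open>exp (gamma * t)\<close>, an increasing bijection between the
  extended reals and \<open>ennreal\<close>; hence it commutes with minima.\<close>

definition certainty_equivalent :: "ennreal \<Rightarrow> ereal" where
  "certainty_equivalent y = ereal (1 / risk_av P) * ln_ennreal y"

lemma certainty_equivalent_mono: "y \<le> y' \<Longrightarrow> certainty_equivalent y \<le> certainty_equivalent y'"
  unfolding certainty_equivalent_def using risk_av_pos
  by (intro ereal_mult_left_mono ln_ennreal_mono) auto

lemma certainty_equivalent_min:
  "certainty_equivalent (min y y') = min (certainty_equivalent y) (certainty_equivalent y')"
  by (metis certainty_equivalent_mono linear min_absorb1 min_absorb2)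

lemma certainty_equivalent_exercise: "certainty_equivalent (exp_exercise z) = ereal (exercise_cost z)"
  using risk_av_pos by (simp add: certainty_equivalent_def exp_exercise_def ln_ennreal_def)

lemma certainty_equivalent_exp: "certainty_equivalent (exp_ereal (ereal (risk_av P) * t)) = t"
  using risk_av_pos by (simp add: certainty_equivalent_def ln_exp_ereal mult.assoc[symmetric])

lemma exp_certainty_equivalent: "exp_ereal (ereal (risk_av P) * certainty_equivalent y) = y"
  using risk_av_pos by (simp add: certainty_equivalent_def exp_ln_ennreal mult.assoc[symmetric])

text \<open>The common factor \<open>exp (gamma * (x - q * S))\<close> is positive and finite and
  cancels. The condition is thereby free of \<open>x\<close> and determines \<open>\<theta>\<close>
  up to the horizon.\<close>

lemma change_of_variables_iff:
  "change_of_variables P \<theta> \<longleftrightarrow>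
    (\<forall>n \<le> horizon P. \<forall>q S A. exp_ereal (ereal (risk_av P) * \<theta> n q S A) = exp_value n (q, S, A))"
proof -
  have "value_fn P n x q S A
      = - enn2ereal (exp_ereal (ereal (- risk_av P) * (ereal (- x + q * S) - \<theta> n q S A)))
    \<longleftrightarrow> exp_ereal (ereal (risk_av P) * \<theta> n q S A) = exp_value n (q, S, A)"
    if "n \<le> horizon P" for n x q S A
  proof -
    have "exp (- risk_av P * (- x + q * S)) = exp (risk_av P * (x - q * S))"
      by (simp add: algebra_simps)
    then show ?thesis
      unfolding value_fn_eq[OF that] exp_ereal_affine[OF risk_av_pos]
      by (auto simp: ennreal_mult_cancel_left enn2ereal_inject)
  qed
  then show ?thesis unfolding change_of_variables_def by auto
qed

lemma continuation_term_regular: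
  assumes \<theta>: "change_of_variables P \<theta>" and n: "n < horizon P" and w: "regular w"
  shows "continuation_term P \<theta> w n q S A
    = certainty_equivalent (best_continuation n (exp_value (Suc n)) (q, S, A))"
proof -
  have V: "volume P (Suc n) w = vconst (Suc n)" using w n by (simp add: regular_def)
  have exp_\<theta>: "exp_ereal (ereal (risk_av P) * \<theta> (Suc n) q S A) = exp_value (Suc n) (q, S, A)" for q S A
    using \<theta> n by (simp add: change_of_variables_iff)
  let ?c = "continuation n (exp_value (Suc n)) (q, S, A)"
  have "continuation_term P \<theta> w n q S A = (INF v\<in>{lo n..hi n}. certainty_equivalent (?c v))"
    unfolding continuation_term_def V lo_def hi_def certainty_equivalent_def exp_ereal_affine[OF risk_av_pos] exp_\<theta>
    by (simp add: continuation_def step_weight_def next_state_def)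
  also have "\<dots> = certainty_equivalent (best_continuation n (exp_value (Suc n)) (q, S, A))"
  proof (rule antisym)
    \<comment> \<open>The infimum is attained, so monotonicity alone moves the logarithm through
      it.\<close>
    obtain v where v: "v \<in> {lo n..hi n}" "?c v = best_continuation n (exp_value (Suc n)) (q, S, A)"
      unfolding best_continuation_def
      using lsc_attains_INF[OF lsc_slice[OF lsc_continuation[OF n lsc_exp_value]] compact_Icc, of "lo n" "hi n"]
        lo_le_hi[OF n]
      by force
    show "(INF v\<in>{lo n..hi n}. certainty_equivalent (?c v))
      \<le> certainty_equivalent (best_continuation n (exp_value (Suc n)) (q, S, A))"
      unfolding v(2)[symmetric] by (rule INF_lower[OF v(1)])
    show "certainty_equivalent (best_continuation n (exp_value (Suc n)) (q, S, A))
      \<le> (INF v\<in>{lo n..hi n}. certainty_equivalent (?c v))"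
      unfolding best_continuation_def
      by (intro INF_greatest certainty_equivalent_mono INF_lower)
  qed
  finally show ?thesis .
qed

end

theorem proposition2:
  fixes P :: "'a asr"
  assumes "asr_model P"
  shows "(\<exists>\<theta>. change_of_variables P \<theta>) \<and>
    (\<forall>\<theta>. change_of_variables P \<theta> \<longrightarrow>
      (AE \<omega> in probm P. \<forall>n \<le> horizon P. \<forall>q S A.
        \<theta> n q S A =
          (if n = horizon P then ereal (exercise_term P \<omega> q S A)
           else if n \<in> exercise P then
             min (continuation_term P \<theta> \<omega> n q S A) (ereal (exercise_term P \<omega> q S A))
           else continuation_term P \<theta> \<omega> n q S A)))"
proof -
  interpret asr_model P by fact
  have "change_of_variables P (\<lambda>n q S A. certainty_equivalent (exp_value n (q, S, A)))"
    by (simp add: change_of_variables_iff exp_certainty_equivalent)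
  moreover have "AE \<omega> in probm P. \<forall>n \<le> horizon P. \<forall>q S A.
        \<theta> n q S A =
          (if n = horizon P then ereal (exercise_term P \<omega> q S A)
           else if n \<in> exercise P then
             min (continuation_term P \<theta> \<omega> n q S A) (ereal (exercise_term P \<omega> q S A))
           else continuation_term P \<theta> \<omega> n q S A)"
    if \<theta>: "change_of_variables P \<theta>" for \<theta>
    \<comment> \<open>The one event \<open>regular\<close> serves all \<open>n\<close>,
      \<open>q\<close>, \<open>S\<close> and \<open>A\<close>, so the uncountably many states share
      a single null set.\<close>
    using AE_regular
  proof eventually_elim
    case (elim \<omega>)
    have "\<theta> n q S A = certainty_equivalent (exp_value n (q, S, A))" if "n \<le> horizon P" for n q S A
      using \<theta> that certainty_equivalent_exp[of "\<theta> n q S A"] by (simp add: change_of_variables_iff)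
    then show ?case
      using elim \<theta>
      by (auto simp: exp_value_horizon exp_value_step certainty_equivalent_exercise certainty_equivalent_min
          exercise_term_regular continuation_term_regular)
  qed
  ultimately show ?thesis by blast
qed

end
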